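(* Let $n=mk$. The column-erasure-channel decoding algorithm for the Desarguesian spread code $\mathcal{S}_q(m,k,P)$ described in the context has computational complexity in $O(k^2m+k^3)=O(kn+k^3)$, counted in operations over $\mathbb{F}_q$.
   Context: $q$ is a prime power; $p(x)=x^k+\sum_{i=0}^{k-1}p_ix^i\in\mathbb{F}_q[x]$ is monic irreducible with root $\alpha$, $\mathbb{F}_{q^k}=\mathbb{F}_q[\alpha]$, and $P$ is the companion matrix of $p$ (ones on the subdiagonal, last column $(-p_0,\ldots,-p_{k-1})^\top$, zeros elsewhere). $\mathcal{S}_q(m,k,P)$ is the set of row spaces of the matrices $(0\mid\cdots\mid0\mid I_k\mid B_{i+1}\mid\cdots\mid B_m)\in\mathbb{F}_q^{k\times mk}$ with $1\le i\le m$ ($I_k$ in the $i$-th block) and $B_j\in\mathbb{F}_q[P]$. It is identified with the set $\mathcal{G}_{q^k}(1,m)$ of one-dimensional subspaces of $\mathbb{F}_{q^k}^m$ via $\mathrm{rowsp}(u_1,\ldots,u_m)\mapsto\mathrm{rowsp}(\phi(u_1)\mid\cdots\mid\phi(u_m))$, $\phi(\sum v_i\alpha^i)=\sum v_iP^i$; a codeword is to be output as the normalized basis vector in $\mathbb{F}_{q^k}^m$ (first nonzero entry $1$). Let $\psi:\mathbb{F}_q^k\to\mathbb{F}_{q^k}$, $(v_0,\ldots,v_{k-1})\mapsto\sum v_i\alpha^i$. Elements of $\mathbb{F}_{q^k}$ are stored by their coordinates in the basis $1,\alpha,\ldots,\alpha^{k-1}$, so evaluating $\psi$ is free of cost. Column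 erasure channel without deletions: the sent basis matrix $U\in\mathbb{F}_q^{k\times n}$ is multiplied from the left by an unknown invertible matrix, and every column affected by at least one symbol erasure is replaced by an all-$?$ column. Algorithm. Input: a received matrix $R=(R_1\mid\cdots\mid R_m)\in(\mathbb{F}_q\cup\{?\})^{k\times n}$ with $k\times k$ blocks, having a nonzero block $R_*$ without erasures and at most $k-1$ erased columns in each block. 1. Compute $R_*^{-1}$. 2. For $i=1,\ldots,m$: if $R_i$ is nonzero (in its unerased columns), find a nonzero (unerased) column $\mathbf r^{(i)}$ of $R_i$ with column index $j_i\in\{0,\ldots,k-1\}$, compute $h_i:=\psi(R_*^{-1}\mathbf r^{(i)})$ and $u_i:=\alpha^{-j_i}h_i$; otherwise set $u_i:=0$. 3. Set $\mu:=\min\{i:u_i\neq0\}$ and for $i=1,\ldots,m$ compute $v_i:=u_\mu^{-1}u_i$. Output: $(v_1,\ldots,v_m)$. *)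

theory Defs
  imports
    "Jordan_Normal_Form.VS_Connect"
    "HOL-Library.Landau_Symbols"
    "HOL-Library.Monad_Syntax"
begin

section \<open>The Desarguesian spread code and the column erasure channel\<close>

text \<open>All indices start at 0. A \<open>k \<times> mk\<close> matrix consists of \<open>m\<close> blocks; column \<open>j\<close> of block \<open>i\<close>
  is column \<open>i * k + j\<close> of the matrix.\<close>

definition companion :: "'f::field poly \<Rightarrow> 'f mat" where
  "companion p = (let k = degree p in
     mat k k (\<lambda>(a, b). if b = k - 1 then - coeff p a else if a = Suc b then 1 else 0))"

text \<open>\<open>F_q[P]\<close> for a \<open>k \<times> k\<close> matrix \<open>P\<close>.\<close>
definition matrix_algebra :: "nat \<Rightarrow> 'f::field mat \<Rightarrow> 'f mat set" where
  "matrix_algebra k P =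
     {mat k k (\<lambda>ab. \<Sum>i\<le>degree f. coeff f i * (P ^\<^sub>m i) $$ ab) | f. True}"

definition block_row :: "nat \<Rightarrow> nat \<Rightarrow> (nat \<Rightarrow> 'f mat) \<Rightarrow> 'f mat" where
  "block_row k m B = mat k (m * k) (\<lambda>(a, c). B (c div k) $$ (a, c mod k))"

definition spread_code :: "nat \<Rightarrow> nat \<Rightarrow> 'f::field mat \<Rightarrow> 'f vec set set" where
  "spread_code m k P = {vec_space.row_space (m * k) (block_row k m B) | B i.
     i < m \<and> (\<forall>j<i. B j = 0\<^sub>m k k) \<and> B i = 1\<^sub>m k \<and>
     (\<forall>j. i < j \<and> j < m \<longrightarrow> B j \<in> matrix_algebra k P)}"

text \<open>In received matrices \<^term>\<open>None\<close> is the erasure symbol.\<close>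

definition unerased_column :: "nat \<Rightarrow> 'f option mat \<Rightarrow> nat \<Rightarrow> nat \<Rightarrow> bool" where
  "unerased_column k R i j \<longleftrightarrow> (\<forall>a<k. R $$ (a, i * k + j) \<noteq> None)"

definition nonzero_column :: "nat \<Rightarrow> 'f::zero option mat \<Rightarrow> nat \<Rightarrow> nat \<Rightarrow> bool" where
  "nonzero_column k R i j \<longleftrightarrow>
     unerased_column k R i j \<and> (\<exists>a<k. R $$ (a, i * k + j) \<noteq> Some 0)"

definition nonzero_unerased_block :: "nat \<Rightarrow> 'f::zero option mat \<Rightarrow> nat \<Rightarrow> bool" where
  "nonzero_unerased_block k R i \<longleftrightarrow>
     (\<forall>j<k. unerased_column k R i j) \<and> (\<exists>j<k. nonzero_column k R i j)"

definition received_column :: "nat \<Rightarrow> 'f option mat \<Rightarrow> nat \<Rightarrow> nat \<Rightarrow> 'f vec" where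
  "received_column k R i j = vec k (\<lambda>a. the (R $$ (a, i * k + j)))"

definition received_block :: "nat \<Rightarrow> 'f option mat \<Rightarrow> nat \<Rightarrow> 'f mat" where
  "received_block k R i = mat k k (\<lambda>(a, j). the (R $$ (a, i * k + j)))"

definition erase_columns :: "nat set \<Rightarrow> 'f mat \<Rightarrow> 'f option mat" where
  "erase_columns E A = mat (dim_row A) (dim_col A) (\<lambda>(a, c). if c \<in> E then None else Some (A $$ (a, c)))"

text \<open>The inputs of the decoder: \<open>U\<close> is a basis matrix of a codeword, \<open>A\<close> the unknown invertible
  matrix and \<open>E\<close> the set of columns hit by an erasure.\<close>
definition received :: "nat \<Rightarrow> nat \<Rightarrow> 'f::field mat \<Rightarrow> 'f option mat \<Rightarrow> bool" where
  "received m k P R \<longleftrightarrow>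
     (\<exists>U A E. U \<in> carrier_mat k (m * k) \<and> vec_space.row_space (m * k) U \<in> spread_code m k P \<and>
        A \<in> carrier_mat k k \<and> invertible_mat A \<and> R = erase_columns E (A * U)) \<and>
     (\<exists>i<m. nonzero_unerased_block k R i) \<and>
     (\<forall>i<m. card {j. j < k \<and> \<not> unerased_column k R i j} \<le> k - 1)"


section \<open>The decoding algorithm\<close>

text \<open>The field \<open>F_q[\<alpha>]\<close> lies in a field \<open>'e\<close> containing the image of \<open>F_q\<close> under \<open>\<iota>\<close>.\<close>
definition psi :: "('f \<Rightarrow> 'e::field) \<Rightarrow> 'e \<Rightarrow> 'f vec \<Rightarrow> 'e" where
  "psi \<iota> \<alpha> w = (\<Sum>i<dim_vec w. \<iota> (w $ i) * \<alpha> ^ i)"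

text \<open>\<open>v\<close> is a possible output on input \<open>R\<close>. This is a relation because the algorithm leaves open
  which nonzero unerased block \<open>s\<close> serves as \<open>R\<^sub>*\<close>, and which nonzero unerased column \<open>j i\<close> is
  taken in block \<open>i\<close>.\<close>
definition decoding_output ::
    "nat \<Rightarrow> nat \<Rightarrow> ('f::field \<Rightarrow> 'e::field) \<Rightarrow> 'e \<Rightarrow> 'f option mat \<Rightarrow> (nat \<Rightarrow> 'e) \<Rightarrow> bool" where
  "decoding_output m k \<iota> \<alpha> R v \<longleftrightarrow>
     (\<exists>s Rinv j h u \<mu>.
        s < m \<and> nonzero_unerased_block k R s \<and>
        Rinv \<in> carrier_mat k k \<and> inverts_mat (received_block k R s) Rinv \<and>
        inverts_mat Rinv (received_block k R s) \<and>
        (\<forall>i<m. if \<exists>c<k. nonzero_column k R i c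
               then j i < k \<and> nonzero_column k R i (j i) \<and>
                    h i = psi \<iota> \<alpha> (Rinv *\<^sub>v received_column k R i (j i)) \<and>
                    u i = inverse \<alpha> ^ j i * h i
               else u i = 0) \<and>
        \<mu> < m \<and> u \<mu> \<noteq> 0 \<and> (\<forall>i<\<mu>. u i = 0) \<and>
        (\<forall>i<m. v i = inverse (u \<mu>) * u i))"


section \<open>Programs over a field and their cost\<close>

text \<open>
  A program is an algebraic computation tree. Its memory is a list of cells, each holding a field
  element or the erasure symbol. An instruction appends its result to the memory and passes the
  \<^emph>\<open>address\<close> of the new cell to the rest of the program, never the value; only the two tests let
  values influence the control flow. So a program is independent of the field it is run over, and all
  computation with field elements is visible in the tree. The result of a program consists of
  addresses and is to be read off the final memory.
\<close>

type_synonym addr = nat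

datatype instr = Zero | One | Add addr addr | Sub addr addr | Mul addr addr | Div addr addr

datatype 'x prog =
    Return 'x
  | Instr instr "addr \<Rightarrow> 'x prog"
  | IfZero addr "'x prog" "'x prog"
  | IfErased addr "'x prog" "'x prog"

text \<open>An operation with an erased operand, or a division by zero, yields no field element.\<close>
fun lift_op :: "('f \<Rightarrow> 'f \<Rightarrow> 'f option) \<Rightarrow> 'f option \<Rightarrow> 'f option \<Rightarrow> 'f option" where
  "lift_op f (Some x) (Some y) = f x y"
| "lift_op f _ _ = None"

fun instr_value :: "instr \<Rightarrow> 'f::field option list \<Rightarrow> 'f option" where
  "instr_value Zero M = Some 0"
| "instr_value One M = Some 1"
| "instr_value (Add a b) M = lift_op (\<lambda>x y. Some (x + y)) (M ! a) (M ! b)"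
| "instr_value (Sub a b) M = lift_op (\<lambda>x y. Some (x - y)) (M ! a) (M ! b)"
| "instr_value (Mul a b) M = lift_op (\<lambda>x y. Some (x * y)) (M ! a) (M ! b)"
| "instr_value (Div a b) M = lift_op (\<lambda>x y. if y = 0 then None else Some (x / y)) (M ! a) (M ! b)"

primrec exec :: "'x prog \<Rightarrow> 'f::field option list \<Rightarrow> 'x \<times> 'f option list" where
  "exec (Return x) M = (x, M)"
| "exec (Instr i c) M = exec (c (length M)) (M @ [instr_value i M])"
| "exec (IfZero a s t) M = (if M ! a = Some 0 then exec s M else exec t M)"
| "exec (IfErased a s t) M = (if M ! a = None then exec s M else exec t M)"

text \<open>The worst-case number of operations when started with \<open>n\<close> memory cells: the largest number of
  arithmetic operations, constants and tests on a path of the tree. This bounds the number of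
  operations executed on any input over any field.\<close>
primrec max_ops :: "'x prog \<Rightarrow> nat \<Rightarrow> nat" where
  "max_ops (Return x) n = 0"
| "max_ops (Instr i c) n = Suc (max_ops (c n) (Suc n))"
| "max_ops (IfZero a s t) n = Suc (max (max_ops s n) (max_ops t n))"
| "max_ops (IfErased a s t) n = Suc (max (max_ops s n) (max_ops t n))"

primrec bind_prog :: "'x prog \<Rightarrow> ('x \<Rightarrow> 'y prog) \<Rightarrow> 'y prog" where
  "bind_prog (Return x) f = f x"
| "bind_prog (Instr i c) f = Instr i (\<lambda>a. bind_prog (c a) f)"
| "bind_prog (IfZero a s t) f = IfZero a (bind_prog s f) (bind_prog t f)"
| "bind_prog (IfErased a s t) f = IfErased a (bind_prog s f) (bind_prog t f)"

adhoc_overloading Monad_Syntax.bind \<rightleftharpoons> bind_prog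

abbreviation instr :: "instr \<Rightarrow> addr prog" where
  "instr i \<equiv> Instr i Return"

primrec map_prog :: "('x \<Rightarrow> 'y prog) \<Rightarrow> 'x list \<Rightarrow> 'y list prog" where
  "map_prog f [] = Return []"
| "map_prog f (x # xs) = do {
     y \<leftarrow> f x;
     ys \<leftarrow> map_prog f xs;
     Return (y # ys)
   }"

primrec fold_prog :: "('x \<Rightarrow> 's \<Rightarrow> 's prog) \<Rightarrow> 'x list \<Rightarrow> 's \<Rightarrow> 's prog" where
  "fold_prog f [] s = Return s"
| "fold_prog f (x # xs) s = do {
     s' \<leftarrow> f x s;
     fold_prog f xs s'
   }"


section \<open>The decoder as a program\<close>

text \<open>Vectors are lists of addresses and matrices are lists of rows. The address \<open>z\<close> always points
  to a cell holding 0 and the address \<open>e\<close> to a cell holding 1.\<close>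

subsection \<open>Searching\<close>

primrec any_erased :: "addr list \<Rightarrow> bool prog" where
  "any_erased [] = Return False"
| "any_erased (a # as) = IfErased a (Return True) (any_erased as)"

primrec all_zero :: "addr list \<Rightarrow> bool prog" where
  "all_zero [] = Return True"
| "all_zero (a # as) = IfZero a (all_zero as) (Return False)"

text \<open>The first \<open>x\<close> whose cells are all unerased and not all zero.\<close>
primrec find_nonzero :: "('x \<Rightarrow> addr list) \<Rightarrow> 'x list \<Rightarrow> 'x option prog" where
  "find_nonzero cells [] = Return None"
| "find_nonzero cells (x # xs) = do {
     erased \<leftarrow> any_erased (cells x);
     zero \<leftarrow> (if erased then Return True else all_zero (cells x));
     if zero then find_nonzero cells xs else Return (Some x)
   }"

subsection \<open>Linear algebra over \<open>F_q\<close>\<close>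

definition columns :: "nat \<Rightarrow> addr list list \<Rightarrow> addr list list" where
  "columns k A = map (\<lambda>j. map (\<lambda>r. r ! j) A) [0..<k]"

definition inner_prod :: "addr \<Rightarrow> addr list \<Rightarrow> addr list \<Rightarrow> addr prog" where
  "inner_prod z xs ys = fold_prog (\<lambda>(x, y) s. do {
     t \<leftarrow> instr (Mul x y);
     instr (Add s t)
   }) (zip xs ys) z"

definition mat_vec_mult :: "addr \<Rightarrow> addr list list \<Rightarrow> addr list \<Rightarrow> addr list prog" where
  "mat_vec_mult z A xs = map_prog (\<lambda>r. inner_prod z r xs) A"

definition add_multiple :: "addr \<Rightarrow> addr list \<Rightarrow> addr list \<Rightarrow> addr list prog" where
  "add_multiple c xs ys = map_prog (\<lambda>(x, y). do {
     t \<leftarrow> instr (Mul c y);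
     instr (Add x t)
   }) (zip xs ys)"

definition sub_multiple :: "addr \<Rightarrow> addr list \<Rightarrow> addr list \<Rightarrow> addr list prog" where
  "sub_multiple c xs ys = map_prog (\<lambda>(x, y). do {
     t \<leftarrow> instr (Mul c y);
     instr (Sub x t)
   }) (zip xs ys)"

text \<open>The first row with a nonzero entry in column \<open>c\<close>, and the remaining rows.\<close>
primrec extract_pivot :: "nat \<Rightarrow> addr list list \<Rightarrow> (addr list \<times> addr list list) option prog" where
  "extract_pivot c [] = Return None"
| "extract_pivot c (r # rs) = IfZero (r ! c)
     (do {
        res \<leftarrow> extract_pivot c rs;
        Return (map_option (\<lambda>(piv, rest). (piv, r # rest)) res)
      })
     (Return (Some (r, rs)))"

text \<open>Gauss-Jordan elimination on the columns in the first argument. The second argument holds the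
  pivot rows found so far, in the order of their columns, the third one the other rows. A missing
  pivot, which means that the matrix is singular, ends the elimination.\<close>
primrec gauss_jordan :: "nat list \<Rightarrow> addr list list \<Rightarrow> addr list list \<Rightarrow> addr list list prog" where
  "gauss_jordan [] pivs rs = Return (pivs @ rs)"
| "gauss_jordan (c # cs) pivs rs = do {
     res \<leftarrow> extract_pivot c rs;
     (case res of
        None \<Rightarrow> Return (pivs @ rs)
      | Some (piv, rest) \<Rightarrow> do {
          piv' \<leftarrow> map_prog (\<lambda>x. instr (Div x (piv ! c))) piv;
          pivs' \<leftarrow> map_prog (\<lambda>r. sub_multiple (r ! c) r piv') pivs;
          rest' \<leftarrow> map_prog (\<lambda>r. sub_multiple (r ! c) r piv') rest;
          gauss_jordan cs (pivs' @ [piv']) rest'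
        })
   }"

definition mat_inv :: "addr \<Rightarrow> addr \<Rightarrow> nat \<Rightarrow> addr list list \<Rightarrow> addr list list prog" where
  "mat_inv z e k A = do {
     rs \<leftarrow> gauss_jordan [0..<k] [] (map (\<lambda>i. A ! i @ map (\<lambda>j. if i = j then e else z) [0..<k]) [0..<k]);
     Return (map (drop k) rs)
   }"

subsection \<open>Arithmetic in \<open>F_q[\<alpha>]\<close>, in the basis \<open>1, \<alpha>, \<dots>, \<alpha>\<^sup>k\<^sup>-\<^sup>1\<close>\<close>

text \<open>The list \<open>ps\<close> holds the coefficients \<open>p\<^sub>0, \<dots>, p\<^sub>k\<^sub>-\<^sub>1\<close>, where
  \<open>\<alpha>\<^sup>k = - (p\<^sub>0 + \<dots> + p\<^sub>k\<^sub>-\<^sub>1 \<alpha>\<^sup>k\<^sup>-\<^sup>1)\<close>.\<close>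

definition times_alpha :: "addr \<Rightarrow> addr list \<Rightarrow> addr list \<Rightarrow> addr list prog" where
  "times_alpha z ps xs = sub_multiple (last xs) (z # butlast xs) ps"

text \<open>With \<open>t = x\<^sub>0 / p\<^sub>0\<close>, all coordinates of \<open>x - t p(\<alpha>) = x\<close> are shifted down by one; the last
  one is \<open>- t\<close> because \<open>p\<close> is monic.\<close>
definition div_alpha :: "addr \<Rightarrow> addr list \<Rightarrow> addr list \<Rightarrow> addr list prog" where
  "div_alpha z ps xs = do {
     t \<leftarrow> instr (Div (hd xs) (hd ps));
     ys \<leftarrow> sub_multiple t (tl xs) (tl ps);
     y \<leftarrow> instr (Sub z t);
     Return (ys @ [y])
   }"

primrec div_alpha_pow :: "addr \<Rightarrow> addr list \<Rightarrow> nat \<Rightarrow> addr list \<Rightarrow> addr list prog" where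
  "div_alpha_pow z ps 0 xs = Return xs"
| "div_alpha_pow z ps (Suc j) xs = do {
     ys \<leftarrow> div_alpha z ps xs;
     div_alpha_pow z ps j ys
   }"

text \<open>Horner's scheme for \<open>(\<Sum>i. x\<^sub>i \<alpha>\<^sup>i) y\<close>.\<close>
definition ext_mult :: "addr \<Rightarrow> addr list \<Rightarrow> addr list \<Rightarrow> addr list \<Rightarrow> addr list prog" where
  "ext_mult z ps xs ys = fold_prog (\<lambda>x acc. do {
     acc' \<leftarrow> times_alpha z ps acc;
     add_multiple x acc' ys
   }) (rev xs) (replicate (length ps) z)"

primrec alpha_multiples :: "addr \<Rightarrow> addr list \<Rightarrow> nat \<Rightarrow> addr list \<Rightarrow> addr list list prog" where
  "alpha_multiples z ps 0 xs = Return []"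
| "alpha_multiples z ps (Suc n) xs = do {
     ys \<leftarrow> times_alpha z ps xs;
     yss \<leftarrow> alpha_multiples z ps n ys;
     Return (xs # yss)
   }"

text \<open>The matrix with columns \<open>x, \<alpha> x, \<dots>, \<alpha>\<^sup>k\<^sup>-\<^sup>1 x\<close> describes the multiplication by \<open>x\<close>; the first
  column of its inverse holds the coordinates of \<open>1 / x\<close>.\<close>
definition ext_inverse :: "addr \<Rightarrow> addr \<Rightarrow> addr list \<Rightarrow> addr list \<Rightarrow> addr list prog" where
  "ext_inverse z e ps xs = do {
     multiples \<leftarrow> alpha_multiples z ps (length ps) xs;
     N \<leftarrow> mat_inv z e (length ps) (columns (length ps) multiples);
     Return (map hd N)
   }"

subsection \<open>The algorithm\<close>

text \<open>The memory initially holds \<open>p\<^sub>0, \<dots>, p\<^sub>k\<^sub>-\<^sub>1\<close> followed by the rows of \<open>R\<close>.\<close>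

definition input_memory :: "'f::field poly \<Rightarrow> 'f option mat \<Rightarrow> 'f option list" where
  "input_memory p R = map (\<lambda>i. Some (coeff p i)) [0..<degree p] @
     concat (map (\<lambda>a. map (\<lambda>c. R $$ (a, c)) [0..<dim_col R]) [0..<dim_row R])"

definition input_size :: "nat \<Rightarrow> nat \<Rightarrow> nat" where
  "input_size m k = k + k * (m * k)"

definition block_addrs :: "nat \<Rightarrow> nat \<Rightarrow> nat \<Rightarrow> addr list list" where
  "block_addrs m k i = map (\<lambda>a. map (\<lambda>j. k + a * (m * k) + (i * k + j)) [0..<k]) [0..<k]"

definition decode_block :: "addr \<Rightarrow> addr list \<Rightarrow> addr list list \<Rightarrow> addr list list \<Rightarrow> addr list prog" where
  "decode_block z ps Rinv B = do {
     res \<leftarrow> find_nonzero snd (zip [0..<length ps] (columns (length ps) B));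
     (case res of
        None \<Rightarrow> Return (replicate (length ps) z)
      | Some (j, r) \<Rightarrow> do {
          h \<leftarrow> mat_vec_mult z Rinv r;
          div_alpha_pow z ps j h
        })
   }"

text \<open>The result consists of the coordinates of \<open>v\<^sub>1, \<dots>, v\<^sub>m\<close>. The two cases returning \<^term>\<open>[]\<close> do not
  occur on inputs of the decoder.\<close>
definition decoder :: "nat \<Rightarrow> nat \<Rightarrow> addr list list prog" where
  "decoder m k = (let ps = [0..<k]; blocks = map (block_addrs m k) [0..<m] in do {
     z \<leftarrow> instr Zero;
     e \<leftarrow> instr One;
     star \<leftarrow> find_nonzero concat blocks;
     (case star of
        None \<Rightarrow> Return []
      | Some B \<Rightarrow> do {
          Rinv \<leftarrow> mat_inv z e k B;
          us \<leftarrow> map_prog (decode_block z ps Rinv) blocks;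
          first \<leftarrow> find_nonzero (\<lambda>u. u) us;
          (case first of
             None \<Rightarrow> Return []
           | Some u \<Rightarrow> do {
               w \<leftarrow> ext_inverse z e ps u;
               map_prog (ext_mult z ps w) us
             })
        })
   })"

definition run_decoder :: "nat \<Rightarrow> nat \<Rightarrow> 'f::field poly \<Rightarrow> 'f option mat \<Rightarrow> 'f option list list" where
  "run_decoder m k p R =
     (let (vs, M) = exec (decoder m k) (input_memory p R) in map (map ((!) M)) vs)"

definition decoder_complexity :: "nat \<times> nat \<Rightarrow> nat" where
  "decoder_complexity = (\<lambda>(m, k). max_ops (decoder m k) (input_size m k))"

text \<open>Big-O for functions of \<open>(m, k)\<close>, with one constant for all \<open>m, k \<ge> 1\<close>.\<close>
abbreviation bigO_params :: "(nat \<times> nat \<Rightarrow> real) \<Rightarrow> (nat \<times> nat \<Rightarrow> real) set" where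
  "bigO_params g \<equiv> O[principal {(m, k). m \<ge> 1 \<and> k \<ge> 1}](g)"

end

theory Submission
  imports Defs "HOL-Library.Sublist" "Jordan_Normal_Form.Char_Poly"
begin

text \<open>
  The cost is read off the program: a block needs a search, one product of a \<open>k \<times> k\<close> matrix with a
  vector, at most \<open>k\<close> divisions by \<open>\<alpha>\<close> and one multiplication in \<open>F_q[\<alpha>]\<close>, each in \<open>O(k\<^sup>2)\<close>, and
  there are only two matrix inversions, each in \<open>O(k\<^sup>3)\<close>.

  The decoder works because both inverted matrices are regular. As \<open>p\<close> is irreducible,
  \<open>1, \<alpha>, \<dots>, \<alpha>\<^sup>k\<^sup>-\<^sup>1\<close> are linearly independent over \<open>F_q\<close>, and in these coordinates the companion
  matrix is the multiplication by \<open>\<alpha>\<close>, so every \<open>B \<in> F_q[P]\<close> is the multiplication by some element and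
  is either zero or injective. The basis matrix \<open>U\<close> of a codeword and the row \<open>(0 | I | B)\<close> have
  the same row space, hence the same kernel; restricted to the vectors supported in one block this
  says that the block of \<open>A U\<close> has the kernel of the block of \<open>(0 | I | B)\<close>.
\<close>

section \<open>Bounding the number of operations\<close>

text \<open>The two halves of the proof are independent of each other. The cost bound inspects every
  path of the tree, including those that no input takes, and uses nothing about fields; it only
  keeps track of the lengths of address lists. Correctness follows the one path taken on a received
  word. There the obstacle is that the program handles addresses while the specification speaks of
  field elements. Since programs only append to the memory, a fact about a cell stays true once it
  is established, and each intermediate list of addresses can be tied to the vector, matrix or
  element of the extension that it stores. The specification being a relation, the first hits of the
  searches serve as its witnesses. One degenerate case needs care: for \<open>k = 1\<close> and
  \<open>p = x\<close> the root \<alpha> is 0 and cannot be divided by. But then every block has a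
  single column, of index 0, and no division by \<alpha> is executed.\<close>

text \<open>Quantifying over all addresses, and not only those that occur, makes this bound independent of
  the size of the memory.\<close>

primrec bounded :: "'x prog \<Rightarrow> nat \<Rightarrow> ('x \<Rightarrow> bool) \<Rightarrow> bool" where
  "bounded (Return x) c Q \<longleftrightarrow> Q x"
| "bounded (Instr i f) c Q \<longleftrightarrow> 0 < c \<and> (\<forall>a. bounded (f a) (c - 1) Q)"
| "bounded (IfZero a s t) c Q \<longleftrightarrow> 0 < c \<and> bounded s (c - 1) Q \<and> bounded t (c - 1) Q"
| "bounded (IfErased a s t) c Q \<longleftrightarrow> 0 < c \<and> bounded s (c - 1) Q \<and> bounded t (c - 1) Q"

lemma max_ops_le: "bounded p c Q \<Longrightarrow> max_ops p n \<le> c"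
proof (induction p arbitrary: c n)
  case (Instr i f)
  then have "max_ops (f n) (Suc n) \<le> c - 1"
    by auto
  with Instr.prems show ?case
    by auto
next
  case (IfZero a s t)
  then have "max_ops s n \<le> c - 1" "max_ops t n \<le> c - 1"
    by auto
  with IfZero.prems show ?case
    by auto
next
  case (IfErased a s t)
  then have "max_ops s n \<le> c - 1" "max_ops t n \<le> c - 1"
    by auto
  with IfErased.prems show ?case
    by auto
qed simp

lemma bounded_mono:
  "bounded p c Q \<Longrightarrow> c \<le> d \<Longrightarrow> (\<And>x. Q x \<Longrightarrow> Q' x) \<Longrightarrow> bounded p d Q'"
proof (induction p arbitrary: c d)
  case (Instr i f)
  then have "bounded (f a) (d - 1) Q'" for a
    by (intro Instr.IH[of "f a" "c - 1"]) auto
  with Instr.prems show ?case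
    by auto
next
  case (IfZero a s t)
  have "bounded s (d - 1) Q'" "bounded t (d - 1) Q'"
    using IfZero.prems by (auto intro: IfZero.IH[of "c - 1"])
  with IfZero.prems show ?case
    by auto
next
  case (IfErased a s t)
  have "bounded s (d - 1) Q'" "bounded t (d - 1) Q'"
    using IfErased.prems by (auto intro: IfErased.IH[of "c - 1"])
  with IfErased.prems show ?case
    by auto
qed simp

text \<open>Costs add along a path. The postcondition \<open>Q\<close> passes on the lengths of the
  address lists returned by the first part, on which the cost of the continuation depends.\<close>

lemma bounded_bind:
  assumes "bounded p c Q" "\<And>x. Q x \<Longrightarrow> bounded (f x) d Q'" "c + d \<le> b"
  shows "bounded (bind_prog p f) b Q'"
  using assms(1,3)
proof (induction p arbitrary: c b)
  case (Return x)
  then show ?case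
    using bounded_mono[OF assms(2)] by auto
next
  case (Instr i g)
  then have "bounded (bind_prog (g a) f) (b - 1) Q'" for a
    by (intro Instr.IH[of "g a" "c - 1"]) auto
  with Instr.prems show ?case
    by auto
next
  case (IfZero a s t)
  have "bounded (bind_prog s f) (b - 1) Q'" "bounded (bind_prog t f) (b - 1) Q'"
    using IfZero.prems by (auto intro!: IfZero.IH[of "c - 1"])
  with IfZero.prems show ?case
    by auto
next
  case (IfErased a s t)
  have "bounded (bind_prog s f) (b - 1) Q'" "bounded (bind_prog t f) (b - 1) Q'"
    using IfErased.prems by (auto intro!: IfErased.IH[of "c - 1"])
  with IfErased.prems show ?case
    by auto
qed

lemma bounded_map_prog:
  assumes "\<And>x. x \<in> set xs \<Longrightarrow> bounded (f x) c Q" "length xs * c \<le> d"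
  shows "bounded (map_prog f xs) d (\<lambda>ys. length ys = length xs \<and> (\<forall>y\<in>set ys. Q y))"
  using assms
proof (induction xs arbitrary: d)
  case (Cons x xs)
  have IH: "bounded (map_prog f xs) (length xs * c)
      (\<lambda>ys. length ys = length xs \<and> (\<forall>y\<in>set ys. Q y))"
    using Cons by simp
  show ?case
    unfolding map_prog.simps
    by (rule bounded_bind[where d = "length xs * c" and Q = Q, OF Cons.prems(1)],
        simp, rule bounded_bind[where d = 0, OF IH]) (use Cons.prems in auto)
qed simp

lemma bounded_fold_prog:
  assumes "\<And>x s. x \<in> set xs \<Longrightarrow> Q s \<Longrightarrow> bounded (f x s) c Q" "Q s" "length xs * c \<le> d"
  shows "bounded (fold_prog f xs s) d Q"
  using assms
proof (induction xs arbitrary: s d)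
  case (Cons x xs)
  show ?case
    unfolding fold_prog.simps
    by (rule bounded_bind[where d = "length xs * c", OF Cons.prems(1)])
      (use Cons in auto)
qed simp

lemma bounded_any_erased: "length as \<le> c \<Longrightarrow> bounded (any_erased as) c (\<lambda>_. True)"
  by (induction as arbitrary: c) auto

lemma bounded_all_zero: "length as \<le> c \<Longrightarrow> bounded (all_zero as) c (\<lambda>_. True)"
  by (induction as arbitrary: c) auto

text \<open>Each candidate is scanned at most twice, once for erasures and once for a nonzero cell.
  That the result is one of the candidates gives the later steps a bound on the index or the length
  of what was found.\<close>

lemma bounded_find_nonzero:
  assumes "\<And>x. x \<in> set xs \<Longrightarrow> length (cells x) \<le> l" "length xs * (2 * l) \<le> c"
  shows "bounded (find_nonzero cells xs) c (\<lambda>res. set_option res \<subseteq> set xs)"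
  using assms
proof (induction xs arbitrary: c)
  case (Cons x xs)
  have l: "length (cells x) \<le> l"
    using Cons.prems by simp
  have "bounded (if b then Return True else all_zero (cells x)) l (\<lambda>_. True)" for b
    using l by (auto intro: bounded_all_zero)
  moreover have "bounded (if b then find_nonzero cells xs else Return (Some x)) (length xs * (2 * l))
     (\<lambda>res. set_option res \<subseteq> set (x # xs))" for b
  proof (cases b)
    case True
    have "bounded (find_nonzero cells xs) (length xs * (2 * l)) (\<lambda>res. set_option res \<subseteq> set xs)"
      using Cons by simp
    with True show ?thesis
      by (auto intro: bounded_mono)
  qed simp
  ultimately have "bounded (bind_prog (if b then Return True else all_zero (cells x))
      (\<lambda>zero. if zero then find_nonzero cells xs else Return (Some x))) (l + length xs * (2 * l))
      (\<lambda>res. set_option res \<subseteq> set (x # xs))" for b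
    by (rule bounded_bind) simp
  then show ?case
    unfolding find_nonzero.simps using Cons.prems(2)
    by (intro bounded_bind[OF bounded_any_erased[OF l], where d = "l + length xs * (2 * l)"]) simp_all
qed simp

section \<open>Operation counts for vectors and matrices\<close>

lemma bounded_inner_prod:
  assumes "2 * length xs \<le> c"
  shows "bounded (inner_prod z xs ys) c (\<lambda>_. True)"
  unfolding inner_prod_def
  by (rule bounded_fold_prog[where c = 2]) (use assms in auto)

lemma bounded_mat_vec_mult:
  assumes "\<forall>r\<in>set A. length r \<le> l" "length A * (2 * l) \<le> c"
  shows "bounded (mat_vec_mult z A xs) c (\<lambda>ys. length ys = length A)"
  unfolding mat_vec_mult_def
  by (rule bounded_mono[OF bounded_map_prog[where c = "2 * l"]])
    (use assms in \<open>auto intro: bounded_inner_prod\<close>)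

text \<open>\<open>zip\<close> truncates to the shorter list, so the bound in terms of
  \<open>ys\<close> holds for every \<open>xs\<close>. Upper bounds on lengths are enough, as all
  costs are monotone in them.\<close>

lemma bounded_add_multiple:
  assumes "2 * length ys \<le> c"
  shows "bounded (add_multiple a xs ys) c (\<lambda>zs. length zs \<le> length ys)"
  unfolding add_multiple_def
  by (rule bounded_mono[OF bounded_map_prog[where c = 2 and Q = "\<lambda>_. True"]])
    (use assms in auto)

lemma bounded_sub_multiple:
  assumes "2 * length ys \<le> c"
  shows "bounded (sub_multiple a xs ys) c (\<lambda>zs. length zs \<le> length ys)"
  unfolding sub_multiple_def
  by (rule bounded_mono[OF bounded_map_prog[where c = 2 and Q = "\<lambda>_. True"]])
    (use assms in auto)

lemma bounded_extract_pivot: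
  "length rs \<le> d \<Longrightarrow> bounded (extract_pivot c rs) d (\<lambda>res. \<forall>piv rest. res = Some (piv, rest) \<longrightarrow>
     piv \<in> set rs \<and> set rest \<subseteq> set rs \<and> Suc (length rest) = length rs)"
proof (induction rs arbitrary: d)
  case (Cons r rs)
  let ?Q = "\<lambda>rs res. \<forall>piv rest. res = Some (piv, rest) \<longrightarrow>
     piv \<in> set rs \<and> set rest \<subseteq> set rs \<and> Suc (length rest) = length rs"
  have IH: "bounded (extract_pivot c rs) (length rs) (?Q rs)"
    by (rule Cons.IH) simp
  have "bounded (bind_prog (extract_pivot c rs)
      (\<lambda>res. Return (map_option (\<lambda>(piv, rest). (piv, r # rest)) res))) (d - 1) (?Q (r # rs))"
    by (rule bounded_bind[OF IH, where d = 0]) (use Cons.prems in auto)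
  then show ?case
    using Cons.prems by auto
qed simp

text \<open>Per column there are at most \<open>k\<close> tests for a pivot, \<open>l\<close>
  divisions to scale its row, and \<open>2 * l\<close> operations for each row to be cleared. Pivot
  rows and other rows are each estimated by \<open>k\<close> rows, whence \<open>4 * k * l\<close>.
  Moving one row from \<open>rs\<close> to \<open>pivs\<close> keeps the total at \<open>k\<close>
  rows.\<close>

lemma bounded_gauss_jordan:
  assumes "\<forall>r\<in>set pivs \<union> set rs. length r \<le> l" "length pivs + length rs = k"
    "length cs * (k + l + 4 * k * l) \<le> d"
  shows "bounded (gauss_jordan cs pivs rs) d (\<lambda>N. length N = k \<and> (\<forall>r\<in>set N. length r \<le> l))"
  using assms
proof (induction cs arbitrary: pivs rs d)
  case (Cons c cs)
  define d' where "d' = length cs * (k + l + 4 * k * l)"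
  let ?Q = "\<lambda>N. length N = k \<and> (\<forall>r\<in>set N. length r \<le> l)"
  have eliminate: "bounded (map_prog (\<lambda>r. sub_multiple (r ! c) r piv') ys) (2 * k * l)
     (\<lambda>zs. length zs = length ys \<and> (\<forall>z\<in>set zs. length z \<le> l))"
    if "length piv' \<le> l" "length ys \<le> k" for piv' ys
  proof (rule bounded_map_prog)
    show "bounded (sub_multiple (r ! c) r piv') (2 * l) (\<lambda>z. length z \<le> l)" for r
      by (rule bounded_mono[OF bounded_sub_multiple[OF order_refl]]) (use that in auto)
    show "length ys * (2 * l) \<le> 2 * k * l"
      using that by simp
  qed
  have step: "bounded (bind_prog (map_prog (\<lambda>x. instr (Div x (piv ! c))) piv) (\<lambda>piv'.
      bind_prog (map_prog (\<lambda>r. sub_multiple (r ! c) r piv') pivs) (\<lambda>pivs'.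
      bind_prog (map_prog (\<lambda>r. sub_multiple (r ! c) r piv') rest) (\<lambda>rest'.
      gauss_jordan cs (pivs' @ [piv']) rest')))) (l + (2 * k * l + (2 * k * l + d'))) ?Q"
    if "piv \<in> set rs" "set rest \<subseteq> set rs" "Suc (length rest) = length rs" for piv rest
  proof (rule bounded_bind[where c = l and d = "2 * k * l + (2 * k * l + d')"])
    have len: "length piv \<le> l"
      using Cons.prems(1) that by auto
    show "bounded (map_prog (\<lambda>x. instr (Div x (piv ! c))) piv) l (\<lambda>piv'. length piv' \<le> l)"
      by (rule bounded_mono[OF bounded_map_prog[where c = 1 and Q = "\<lambda>_. True"]]) (use len in auto)
    fix piv' assume piv': "length (piv' :: addr list) \<le> l"
    show "bounded (bind_prog (map_prog (\<lambda>r. sub_multiple (r ! c) r piv') pivs) (\<lambda>pivs'.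
      bind_prog (map_prog (\<lambda>r. sub_multiple (r ! c) r piv') rest) (\<lambda>rest'.
      gauss_jordan cs (pivs' @ [piv']) rest'))) (2 * k * l + (2 * k * l + d')) ?Q"
    proof (rule bounded_bind[OF eliminate[OF piv'], where d = "2 * k * l + d'"])
      fix pivs' assume pivs': "length (pivs' :: addr list list) = length pivs \<and> (\<forall>r\<in>set pivs'. length r \<le> l)"
      show "bounded (bind_prog (map_prog (\<lambda>r. sub_multiple (r ! c) r piv') rest) (\<lambda>rest'.
        gauss_jordan cs (pivs' @ [piv']) rest')) (2 * k * l + d') ?Q"
      proof (rule bounded_bind[OF eliminate[OF piv'], where d = d'])
        show "bounded (gauss_jordan cs (pivs' @ [piv']) rest') d' ?Q"
          if "length rest' = length rest \<and> (\<forall>r\<in>set rest'. length r \<le> l)" for rest'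
          unfolding d'_def
          by (rule Cons.IH) (use Cons.prems \<open>Suc (length rest) = length rs\<close> that piv' pivs' in auto)
      qed (use Cons.prems \<open>Suc (length rest) = length rs\<close> in auto)
    qed (use Cons.prems in auto)
  qed simp
  have "bounded (case res of None \<Rightarrow> Return (pivs @ rs) | Some (piv, rest) \<Rightarrow>
      bind_prog (map_prog (\<lambda>x. instr (Div x (piv ! c))) piv) (\<lambda>piv'.
      bind_prog (map_prog (\<lambda>r. sub_multiple (r ! c) r piv') pivs) (\<lambda>pivs'.
      bind_prog (map_prog (\<lambda>r. sub_multiple (r ! c) r piv') rest) (\<lambda>rest'.
      gauss_jordan cs (pivs' @ [piv']) rest')))) (l + (2 * k * l + (2 * k * l + d'))) ?Q"
    if "\<forall>piv rest. res = Some (piv, rest) \<longrightarrow>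
      piv \<in> set rs \<and> set rest \<subseteq> set rs \<and> Suc (length rest) = length rs" for res
    using that Cons.prems step by (auto split: option.splits)
  note step' = this
  have "length rs \<le> k"
    using Cons.prems by simp
  then show ?case
    unfolding gauss_jordan.simps
  proof (rule bounded_bind[OF bounded_extract_pivot step'])
    show "k + (l + (2 * k * l + (2 * k * l + d'))) \<le> d"
      using Cons.prems(3) by (simp add: d'_def algebra_simps)
  qed
qed auto

lemma bounded_mat_inv:
  assumes "length A = k" "\<forall>r\<in>set A. length r \<le> k" "0 < k"
  shows "bounded (mat_inv z e k A) (11 * k ^ 3) (\<lambda>N. length N = k \<and> (\<forall>r\<in>set N. length r \<le> k))"
proof -
  have "bounded (gauss_jordan [0..<k] []
      (map (\<lambda>i. A ! i @ map (\<lambda>j. if i = j then e else z) [0..<k]) [0..<k])) (11 * k ^ 3)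
      (\<lambda>N. length N = k \<and> (\<forall>r\<in>set N. length r \<le> 2 * k))"
  proof (rule bounded_gauss_jordan)
    \<comment> \<open>Rows of \<open>(A | I)\<close> have length \<open>2 * k\<close>, so a column
      costs \<open>3 * k + 8 * k ^ 2\<close>; by \<open>k \<le> k ^ 2\<close> the coefficients add
      up to 11.\<close>
    have "k + 2 * k + 4 * k * (2 * k) \<le> 11 * k ^ 2"
      by (simp add: power2_eq_square)
    then show "length [0..<k] * (k + 2 * k + 4 * k * (2 * k)) \<le> 11 * k ^ 3"
      using mult_left_mono[of _ _ k] by (simp add: power3_eq_cube power2_eq_square)
  qed (use assms in \<open>auto simp: set_conv_nth\<close>)
  then show ?thesis
    unfolding mat_inv_def by (rule bounded_bind[where d = 0]) auto
qed

section \<open>Operation counts in the extension field\<close>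

lemma bounded_times_alpha:
  "2 * length ps \<le> c \<Longrightarrow> bounded (times_alpha z ps xs) c (\<lambda>ys. length ys \<le> length ps)"
  unfolding times_alpha_def by (rule bounded_sub_multiple)

text \<open>One division, two operations for each of the \<open>length ps - 1\<close> remaining
  coordinates and one final subtraction add up to exactly \<open>2 * length ps\<close>.\<close>

lemma bounded_div_alpha:
  assumes "ps \<noteq> []" "2 * length ps \<le> c"
  shows "bounded (div_alpha z ps xs) c (\<lambda>ys. length ys \<le> length ps)"
proof -
  obtain c' where c': "2 * length ps = Suc c'" "2 * length (tl ps) + 1 = c'"
    using assms by (cases ps) auto
  have "bounded (bind_prog (sub_multiple t (tl xs) (tl ps)) (\<lambda>ys.
      bind_prog (instr (Sub z t)) (\<lambda>y. Return (ys @ [y])))) c' (\<lambda>ys. length ys \<le> length ps)" for t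
    by (rule bounded_bind[OF bounded_sub_multiple[OF order_refl], where d = 1])
      (use c' in auto)
  then show ?thesis
    unfolding div_alpha_def using assms(2) c'
    by (intro bounded_bind[where c = 1 and Q = "\<lambda>_. True" and d = c' and p = "instr _"]) simp_all
qed

lemma bounded_div_alpha_pow:
  assumes "ps \<noteq> []" "length xs \<le> length ps" "j * (2 * length ps) \<le> c"
  shows "bounded (div_alpha_pow z ps j xs) c (\<lambda>ys. length ys \<le> length ps)"
  using assms(2,3)
proof (induction j arbitrary: xs c)
  case (Suc j)
  show ?case
    unfolding div_alpha_pow.simps
    by (rule bounded_bind[OF bounded_div_alpha[OF assms(1) order_refl], where d = "j * (2 * length ps)"])
      (use Suc in auto)
qed simp

lemma bounded_ext_mult:
  assumes "length xs \<le> k" "length ys \<le> k" "length ps = k"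
  shows "bounded (ext_mult z ps xs ys) (4 * k ^ 2) (\<lambda>zs. True)"
proof -
  have "bounded (bind_prog (times_alpha z ps acc) (\<lambda>acc'. add_multiple x acc' ys)) (4 * k) (\<lambda>_. True)"
    for x acc
    by (rule bounded_bind[OF bounded_times_alpha[OF order_refl]],
        rule bounded_mono[OF bounded_add_multiple[OF order_refl], where d = "2 * k"])
      (use assms in auto)
  moreover have "length (rev xs) * (4 * k) \<le> 4 * k ^ 2"
    using mult_right_mono[OF assms(1), of "4 * k"] by (simp add: power2_eq_square)
  ultimately show ?thesis
    unfolding ext_mult_def by (intro bounded_fold_prog[where c = "4 * k"]) auto
qed

lemma bounded_alpha_multiples:
  assumes "length xs \<le> length ps" "n * (2 * length ps) \<le> c"
  shows "bounded (alpha_multiples z ps n xs) c (\<lambda>yss. length yss = n)"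
  using assms
proof (induction n arbitrary: xs c)
  case (Suc n)
  have "bounded (bind_prog (alpha_multiples z ps n ys) (\<lambda>yss. Return (xs # yss)))
      (n * (2 * length ps)) (\<lambda>yss. length yss = Suc n)" if "length ys \<le> length ps" for ys
    by (rule bounded_bind[OF Suc.IH[OF that order_refl], where d = 0]) auto
  then show ?case
    unfolding alpha_multiples.simps
    by (intro bounded_bind[OF bounded_times_alpha[OF order_refl]]) (use Suc.prems in auto)
qed simp

text \<open>Generating the \<open>k\<close> multiples takes \<open>2 * k ^ 2\<close> operations,
  absorbed into \<open>2 * k ^ 3\<close>; the other \<open>11 * k ^ 3\<close> are the matrix
  inversion.\<close>

lemma bounded_ext_inverse:
  assumes "length xs \<le> k" "length ps = k" "0 < k"
  shows "bounded (ext_inverse z e ps xs) (13 * k ^ 3) (\<lambda>ys. length ys = k)"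
proof -
  have "bounded (bind_prog (mat_inv z e (length ps) (columns (length ps) xss)) (\<lambda>N. Return (map hd N)))
      (11 * k ^ 3) (\<lambda>ys. length ys = k)" if "length xss = k" for xss
    unfolding assms(2)
    by (rule bounded_bind[OF bounded_mat_inv, where d = 0])
      (use assms that in \<open>auto simp: columns_def\<close>)
  moreover have "k * (2 * k) \<le> 2 * k ^ 3"
    using assms by (simp add: power3_eq_cube)
  ultimately show ?thesis
    unfolding ext_inverse_def
    by (intro bounded_bind[OF bounded_alpha_multiples[where c = "2 * k ^ 3"], where d = "11 * k ^ 3"])
      (use assms in auto)
qed

text \<open>Three contributions of \<open>2 * k ^ 2\<close>: the search through \<open>k\<close>
  columns, the matrix-vector product, and fewer than \<open>k\<close> divisions by \<alpha> with
  \<open>2 * k\<close> operations each.\<close>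

lemma bounded_decode_block:
  assumes "length ps = k" "0 < k" "length Rinv = k" "\<forall>r\<in>set Rinv. length r \<le> k" "length B = k"
  shows "bounded (decode_block z ps Rinv B) (6 * k ^ 2) (\<lambda>ys. length ys \<le> k)"
proof -
  have h: "bounded (bind_prog (mat_vec_mult z Rinv r) (div_alpha_pow z ps j)) (4 * k ^ 2)
      (\<lambda>ys. length ys \<le> k)" if "j < k" for j r
  proof (rule bounded_bind[OF bounded_mat_vec_mult[OF assms(4) order_refl]])
    fix h assume "length (h :: addr list) = length Rinv"
    then show "bounded (div_alpha_pow z ps j h) (k * (2 * k)) (\<lambda>ys. length ys \<le> k)"
      using bounded_div_alpha_pow[of ps h j "k * (2 * k)" z] assms that by force
  qed (use assms in \<open>simp add: power2_eq_square\<close>)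
  show ?thesis
    unfolding decode_block_def assms(1)
  proof (rule bounded_bind[OF bounded_find_nonzero[where l = k, OF _ order_refl]])
    fix res assume "set_option res \<subseteq> set (zip [0..<k] (columns k B))"
    then have "j < k" if "res = Some (j, r)" for j r
      using that by (auto dest: set_zip_leftD)
    then show "bounded (case res of None \<Rightarrow> Return (replicate k z)
        | Some (j, r) \<Rightarrow> bind_prog (mat_vec_mult z Rinv r) (div_alpha_pow z ps j)) (4 * k ^ 2)
        (\<lambda>ys. length ys \<le> k)"
      using h by (auto split: option.splits)
  qed (use assms in \<open>auto simp: columns_def power2_eq_square dest!: set_zip_rightD\<close>)
qed

text \<open>The 14 consists of 2 for the search for an unerased block, 6 for decoding a block, 2 for
  the search for the first nonzero \<open>u\<close> (estimating \<open>m * k\<close> by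
  \<open>m * k ^ 2\<close>), and 4 for the final product. The 24 consists of 11 for inverting the
  block and 13 for inverting \<open>u\<close>. The summand 2 pays for the constants 0 and 1.\<close>

lemma bounded_decoder:
  assumes "1 \<le> k"
  shows "bounded (decoder m k) (2 + 14 * (k ^ 2 * m) + 24 * k ^ 3) (\<lambda>_. True)"
proof -
  let ?blocks = "map (block_addrs m k) [0..<m]"
  let ?ps = "[0..<k]"
  let ?c5 = "13 * k ^ 3 + m * (4 * k ^ 2)"
  let ?c4 = "2 * m * k + ?c5"
  let ?c3 = "m * (6 * k ^ 2) + ?c4"
  let ?c2 = "11 * k ^ 3 + ?c3"
  let ?c1 = "m * (2 * k ^ 2) + ?c2"
  \<comment> \<open>The continuations are bounded from the last one backwards, each fact being the
    premise for the preceding bind.\<close>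
  have invert: "bounded (bind_prog (ext_inverse z e ?ps u) (\<lambda>w. map_prog (ext_mult z ?ps w) us))
      ?c5 (\<lambda>_. True)" if "length u \<le> k" "length us = m" "\<forall>u\<in>set us. length u \<le> k" for z e u us
  proof (rule bounded_bind[OF bounded_ext_inverse])
    fix w assume "length (w :: addr list) = k"
    then show "bounded (map_prog (ext_mult z ?ps w) us) (m * (4 * k ^ 2)) (\<lambda>_. True)"
      using that by (intro bounded_mono[OF bounded_map_prog[OF bounded_ext_mult]]) auto
  qed (use assms that in auto)
  have normalize: "bounded (bind_prog (find_nonzero (\<lambda>u. u) us) (\<lambda>first. case first of None \<Rightarrow> Return []
      | Some u \<Rightarrow> bind_prog (ext_inverse z e ?ps u) (\<lambda>w. map_prog (ext_mult z ?ps w) us)))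
      ?c4 (\<lambda>_. True)" if "length us = m" "\<forall>u\<in>set us. length u \<le> k" for z e us
    by (rule bounded_bind[OF bounded_find_nonzero[where l = k, OF _ order_refl], where d = ?c5])
      (use that invert in \<open>auto split: option.splits\<close>)
  have blocks: "bounded (bind_prog (map_prog (decode_block z ?ps Rinv) ?blocks) (\<lambda>us.
      bind_prog (find_nonzero (\<lambda>u. u) us) (\<lambda>first. case first of None \<Rightarrow> Return []
      | Some u \<Rightarrow> bind_prog (ext_inverse z e ?ps u) (\<lambda>w. map_prog (ext_mult z ?ps w) us))))
      ?c3 (\<lambda>_. True)" if "length Rinv = k" "\<forall>r\<in>set Rinv. length r \<le> k" for z e Rinv
    by (rule bounded_bind[OF bounded_map_prog[where c = "6 * k ^ 2" and Q = "\<lambda>u. length u \<le> k"],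
          where d = ?c4, OF _ order_refl normalize])
      (use assms that in \<open>auto intro!: bounded_decode_block simp: block_addrs_def\<close>)
  have star: "bounded (bind_prog (mat_inv z e k B) (\<lambda>Rinv.
      bind_prog (map_prog (decode_block z ?ps Rinv) ?blocks) (\<lambda>us.
      bind_prog (find_nonzero (\<lambda>u. u) us) (\<lambda>first. case first of None \<Rightarrow> Return []
      | Some u \<Rightarrow> bind_prog (ext_inverse z e ?ps u) (\<lambda>w. map_prog (ext_mult z ?ps w) us)))))
      ?c2 (\<lambda>_. True)" if "B \<in> set ?blocks" for z e B
    by (rule bounded_bind[OF bounded_mat_inv, where d = ?c3])
      (use assms that blocks in \<open>auto simp: block_addrs_def\<close>)
  have find: "bounded (bind_prog (find_nonzero concat ?blocks) (\<lambda>star. case star of None \<Rightarrow> Return []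
      | Some B \<Rightarrow> bind_prog (mat_inv z e k B) (\<lambda>Rinv.
      bind_prog (map_prog (decode_block z ?ps Rinv) ?blocks) (\<lambda>us.
      bind_prog (find_nonzero (\<lambda>u. u) us) (\<lambda>first. case first of None \<Rightarrow> Return []
      | Some u \<Rightarrow> bind_prog (ext_inverse z e ?ps u) (\<lambda>w. map_prog (ext_mult z ?ps w) us))))))
      ?c1 (\<lambda>_. True)" for z e
  proof (rule bounded_bind[OF bounded_find_nonzero[where l = "k ^ 2", OF _ order_refl], where d = ?c2])
    show "length (concat B) \<le> k ^ 2" if "B \<in> set ?blocks" for B
      using that by (auto simp: block_addrs_def length_concat comp_def sum_list_triv power2_eq_square)
  qed (use star in \<open>auto split: option.splits\<close>)
  have "?c1 \<le> 14 * (k ^ 2 * m) + 24 * k ^ 3"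
    using mult_right_mono[OF assms, of "m * k"] by (simp add: power2_eq_square algebra_simps)
  then show ?thesis
    unfolding decoder_def Let_def using bounded_mono[OF find]
    by simp
qed

section \<open>Reasoning about program runs\<close>

text \<open>The weakest precondition of a run started in \<open>M\<close>. Execution is
  deterministic and total, so partial and total correctness coincide.\<close>

definition wp :: "'f::field option list \<Rightarrow> 'x prog \<Rightarrow> ('x \<Rightarrow> 'f option list \<Rightarrow> bool) \<Rightarrow> bool" where
  "wp M p Q \<longleftrightarrow> (case exec p M of (x, M') \<Rightarrow> Q x M')"

lemma exec_bind: "exec (bind_prog p f) M = (case exec p M of (x, M') \<Rightarrow> exec (f x) M')"
  by (induction p arbitrary: M) auto

text \<open>This monotonicity plays the role of a frame rule: whatever is known about existing cells
  survives any further computation. For this reason \<open>wp_mono\<close> and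
  \<open>wp_bind\<close> hand \<open>prefix M M'\<close> to their premises.\<close>

lemma prefix_exec: "prefix M (snd (exec p M))"
proof (induction p arbitrary: M)
  case (Instr i c)
  then show ?case
    by (auto intro: prefix_order.trans[of M "M @ [instr_value i M]"])
qed auto

lemma wp_Return [simp]: "wp M (Return x) Q \<longleftrightarrow> Q x M"
  by (simp add: wp_def)

lemma wp_mono:
  "wp M p Q \<Longrightarrow> (\<And>x M'. prefix M M' \<Longrightarrow> Q x M' \<Longrightarrow> Q' x M') \<Longrightarrow> wp M p Q'"
  using prefix_exec[of M p] by (auto simp: wp_def)

lemma wp_bind:
  "wp M p Q \<Longrightarrow> (\<And>x M'. prefix M M' \<Longrightarrow> Q x M' \<Longrightarrow> wp M' (f x) Q') \<Longrightarrow> wp M (bind_prog p f) Q'"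
  using prefix_exec[of M p] by (auto simp: wp_def exec_bind case_prod_beta)

text \<open>The bound on the address matters: \<open>M ! a\<close> is unspecified beyond the end of
  the memory, and only cells inside it keep their content when the memory grows.\<close>

definition has_val :: "'f option list \<Rightarrow> addr \<Rightarrow> 'f \<Rightarrow> bool" where
  "has_val M a v \<longleftrightarrow> a < length M \<and> M ! a = Some v"

abbreviation has_vals :: "'f option list \<Rightarrow> addr list \<Rightarrow> 'f list \<Rightarrow> bool" where
  "has_vals M \<equiv> list_all2 (has_val M)"

abbreviation has_rows :: "'f option list \<Rightarrow> addr list list \<Rightarrow> 'f list list \<Rightarrow> bool" where
  "has_rows M \<equiv> list_all2 (has_vals M)"

lemma has_val_prefix: "prefix M M' \<Longrightarrow> has_val M a v \<Longrightarrow> has_val M' a v"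
  by (auto simp: has_val_def prefix_def nth_append)

lemma has_vals_prefix: "prefix M M' \<Longrightarrow> has_vals M as vs \<Longrightarrow> has_vals M' as vs"
  by (erule list_all2_mono) (rule has_val_prefix)

lemma has_rows_prefix: "prefix M M' \<Longrightarrow> has_rows M A V \<Longrightarrow> has_rows M' A V"
  by (erule list_all2_mono) (rule has_vals_prefix)

lemmas has_prefix = has_val_prefix has_vals_prefix has_rows_prefix

lemma map_nth_has_vals: "has_vals M as vs \<Longrightarrow> map ((!) M) as = map Some vs"
  by (induction rule: list_all2_induct) (auto simp: has_val_def)

lemma has_vals_nth: "has_vals M as vs \<Longrightarrow> i < length vs \<Longrightarrow> has_val M (as ! i) (vs ! i)"
  by (simp add: list_all2_conv_all_nth)

lemma wp_instr: "wp M (instr i) (\<lambda>a M'. prefix M M' \<and> (\<forall>v. instr_value i M = Some v \<longrightarrow> has_val M' a v))"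
  by (simp add: wp_def has_val_def)

lemma wp_Zero: "wp M (instr Zero) (\<lambda>a M'. has_val M' a 0)"
  by (rule wp_mono[OF wp_instr]) simp

lemma wp_One: "wp M (instr One) (\<lambda>a M'. has_val M' a 1)"
  by (rule wp_mono[OF wp_instr]) simp

lemma wp_Add:
  "has_val M a x \<Longrightarrow> has_val M b y \<Longrightarrow> wp M (instr (Add a b)) (\<lambda>c M'. has_val M' c (x + y))"
  by (rule wp_mono[OF wp_instr]) (simp add: has_val_def)

lemma wp_Sub:
  "has_val M a x \<Longrightarrow> has_val M b y \<Longrightarrow> wp M (instr (Sub a b)) (\<lambda>c M'. has_val M' c (x - y))"
  by (rule wp_mono[OF wp_instr]) (simp add: has_val_def)

lemma wp_Mul:
  "has_val M a x \<Longrightarrow> has_val M b y \<Longrightarrow> wp M (instr (Mul a b)) (\<lambda>c M'. has_val M' c (x * y))"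
  by (rule wp_mono[OF wp_instr]) (simp add: has_val_def)

lemma wp_Div:
  "has_val M a x \<Longrightarrow> has_val M b y \<Longrightarrow> y \<noteq> 0 \<Longrightarrow>
   wp M (instr (Div a b)) (\<lambda>c M'. has_val M' c (x / y))"
  by (rule wp_mono[OF wp_instr]) (simp add: has_val_def)

text \<open>\<open>P\<close> relates the inputs to their abstract values once and for all, whereas
  \<open>S\<close> depends on the current memory. The results for earlier elements have to survive
  the runs on the later ones, hence the persistence of \<open>S\<close>.\<close>

lemma wp_map_prog:
  assumes "list_all2 P xs vs"
    and "\<And>x v M'. P x v \<Longrightarrow> prefix M M' \<Longrightarrow> wp M' (f x) (\<lambda>a M''. S M'' a (g v))"
    and "\<And>M M' a v. prefix M M' \<Longrightarrow> S M a v \<Longrightarrow> S M' a v"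
  shows "wp M (map_prog f xs) (\<lambda>as M'. list_all2 (S M') as (map g vs))"
  using assms(1,2)
proof (induction arbitrary: M rule: list_all2_induct)
  case (Cons x xs v vs)
  have "wp M (f x) (\<lambda>a M'. S M' a (g v))"
    using Cons by simp
  then show ?case
    unfolding map_prog.simps
  proof (rule wp_bind)
    fix a M' assume M': "prefix M M'" "S M' a (g v)"
    then have "wp M' (map_prog f xs) (\<lambda>as M''. list_all2 (S M'') as (map g vs))"
      using Cons.prems by (intro Cons.IH) (auto intro: prefix_order.trans)
    then show "wp M' (bind_prog (map_prog f xs) (\<lambda>as. Return (a # as)))
        (\<lambda>as M'. list_all2 (S M') as (map g (v # vs)))"
      by (rule wp_bind) (use M' assms(3) in auto)
  qed
qed simp

lemma wp_fold_prog:
  assumes "list_all2 P xs vs" "S M s t"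
    and "\<And>x v s t M'. P x v \<Longrightarrow> prefix M M' \<Longrightarrow> S M' s t \<Longrightarrow> wp M' (f x s) (\<lambda>s' M''. S M'' s' (g v t))"
  shows "wp M (fold_prog f xs s) (\<lambda>s' M'. S M' s' (fold g vs t))"
  using assms
proof (induction arbitrary: M s t rule: list_all2_induct)
  case (Cons x xs v vs)
  have "wp M (f x s) (\<lambda>s' M'. S M' s' (g v t))"
    using Cons by simp
  then show ?case
    unfolding fold_prog.simps
  proof (rule wp_bind)
    fix s' M' assume "prefix M M'" "S M' s' (g v t)"
    then show "wp M' (fold_prog f xs s') (\<lambda>s' M'. S M' s' (fold g (v # vs) t))"
      unfolding fold_simps
      by (intro Cons.IH) (auto intro: Cons.prems(2) prefix_order.trans)
  qed
qed simp

subsection \<open>Searching\<close>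

lemma exec_any_erased: "exec (any_erased as) M = (None \<in> (!) M ` set as, M)"
  by (induction as) auto

lemma exec_all_zero: "exec (all_zero as) M = ((!) M ` set as \<subseteq> {Some 0}, M)"
  by (induction as) auto

text \<open>The success condition of the search, shared by its three uses: it is later identified
  with a nonzero unerased block, with a nonzero unerased column, and with
  \<open>x \<noteq> 0\<close> for the coordinates of an element \<open>x\<close>.\<close>

definition nonzero_cells :: "'f::field option list \<Rightarrow> addr list \<Rightarrow> bool" where
  "nonzero_cells M as \<longleftrightarrow> None \<notin> (!) M ` set as \<and> \<not> (!) M ` set as \<subseteq> {Some 0}"

lemma exec_find_nonzero:
  "exec (find_nonzero cells xs) M = (find (\<lambda>x. nonzero_cells M (cells x)) xs, M)"
  by (induction xs) (auto simp: exec_bind exec_any_erased exec_all_zero nonzero_cells_def)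

lemma wp_find_nonzero:
  "wp M (find_nonzero cells xs) (\<lambda>res M'. M' = M \<and> (case res of
     None \<Rightarrow> \<forall>i<length xs. \<not> nonzero_cells M (cells (xs ! i))
   | Some x \<Rightarrow> \<exists>i<length xs. x = xs ! i \<and> nonzero_cells M (cells (xs ! i)) \<and>
       (\<forall>j<i. \<not> nonzero_cells M (cells (xs ! j)))))"
  by (auto simp: wp_def exec_find_nonzero find_None_iff find_Some_iff split: option.splits)

text \<open>Tests leave the memory unchanged. The rows are described by their set and their number
  only, because the order of the remaining rows is irrelevant to the elimination invariant.\<close>

lemma wp_extract_pivot:
  assumes "has_rows M rs V" "\<forall>v\<in>set V. c < length v"
  shows "wp M (extract_pivot c rs) (\<lambda>res M'. M' = M \<and> (case res of
     None \<Rightarrow> \<forall>v\<in>set V. v ! c = 0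
   | Some (piv, rest) \<Rightarrow> \<exists>pivV restV. has_vals M piv pivV \<and> has_rows M rest restV \<and>
       pivV ! c \<noteq> 0 \<and> set V = insert pivV (set restV) \<and> length V = Suc (length restV)))"
  using assms
proof (induction rule: list_all2_induct)
  case (Cons r rs v V)
  have r: "has_val M (r ! c) (v ! c)"
    using Cons by (simp add: has_vals_nth)
  show ?case
  proof (cases "v ! c = 0")
    case True
    have IH: "wp M (extract_pivot c rs) (\<lambda>res M'. M' = M \<and> (case res of
         None \<Rightarrow> \<forall>v\<in>set V. v ! c = 0
       | Some (piv, rest) \<Rightarrow> \<exists>pivV restV. has_vals M piv pivV \<and> has_rows M rest restV \<and>
           pivV ! c \<noteq> 0 \<and> set V = insert pivV (set restV) \<and> length V = Suc (length restV)))"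
      using Cons by simp
    have "wp M (bind_prog (extract_pivot c rs)
        (\<lambda>res. Return (map_option (\<lambda>(piv, rest). (piv, r # rest)) res)))
      (\<lambda>res M'. M' = M \<and> (case res of
         None \<Rightarrow> \<forall>v\<in>set (v # V). v ! c = 0
       | Some (piv, rest) \<Rightarrow> \<exists>pivV restV. has_vals M piv pivV \<and> has_rows M rest restV \<and>
           pivV ! c \<noteq> 0 \<and> set (v # V) = insert pivV (set restV) \<and>
           length (v # V) = Suc (length restV)))"
    proof (rule wp_bind[OF IH], goal_cases)
      case (1 res M')
      show ?case
      proof (cases res)
        case None
        with 1 True show ?thesis by simp
      next
        case (Some pr)
        obtain piv rest where pr: "pr = (piv, rest)"
          by force
        with 1 Some obtain pivV restV where
          "has_vals M piv pivV" "has_rows M rest restV" "pivV ! c \<noteq> 0"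
          "set V = insert pivV (set restV)" "length V = Suc (length restV)"
          by auto
        moreover from this Cons.hyps have "has_rows M (r # rest) (v # restV)"
          by simp
        ultimately have "\<exists>pivV restV. has_vals M piv pivV \<and> has_rows M (r # rest) restV \<and>
           pivV ! c \<noteq> 0 \<and> set (v # V) = insert pivV (set restV) \<and>
           length (v # V) = Suc (length restV)"
          by (intro exI[of _ pivV] exI[of _ "v # restV"]) (simp add: insert_commute)
        with 1 Some pr show ?thesis
          by simp
      qed
    qed
    with r True show ?thesis
      by (simp add: wp_def has_val_def)
  next
    case False
    with r Cons show ?thesis
      by (auto simp: wp_def has_val_def)
  qed
qed simp

subsection \<open>Vector operations\<close>

lemma list_all2_zip_has_vals:
  "has_vals M xs us \<Longrightarrow> has_vals M ys vs \<Longrightarrow>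
   list_all2 (\<lambda>(x, y) (u, v). has_val M x u \<and> has_val M y v) (zip xs ys) (zip us vs)"
  by (auto simp: list_all2_conv_all_nth)

lemma wp_sub_multiple:
  assumes "has_val M a c" "has_vals M xs us" "has_vals M ys vs"
  shows "wp M (sub_multiple a xs ys) (\<lambda>zs M'. has_vals M' zs (map2 (\<lambda>u v. u - c * v) us vs))"
  unfolding sub_multiple_def
proof (rule wp_map_prog[OF list_all2_zip_has_vals[OF assms(2,3)]])
  fix x v M'
  assume "(case x of (x, y) \<Rightarrow> \<lambda>(u, v). has_val M x u \<and> has_val M y v) v" and M': "prefix M M'"
  then obtain y z u w where x: "x = (y, z)" "v = (u, w)" "has_val M y u" "has_val M z w"
    by (auto split: prod.splits)
  have "wp M' (instr (Mul a z)) (\<lambda>t M''. has_val M'' t (c * w))"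
    using x M' assms by (intro wp_Mul) (auto intro: has_prefix)
  then have "wp M' (bind_prog (instr (Mul a z)) (\<lambda>t. instr (Sub y t))) (\<lambda>t M''. has_val M'' t (u - c * w))"
    by (rule wp_bind) (use x M' in \<open>auto intro!: wp_Sub intro: has_prefix prefix_order.trans\<close>)
  with x show "wp M' (case x of (x, y) \<Rightarrow> bind_prog (instr (Mul a y)) (\<lambda>t. instr (Sub x t)))
     (\<lambda>t M''. has_val M'' t (case v of (u, v) \<Rightarrow> u - c * v))"
    by simp
qed (rule has_val_prefix)

lemma wp_add_multiple:
  assumes "has_val M a c" "has_vals M xs us" "has_vals M ys vs"
  shows "wp M (add_multiple a xs ys) (\<lambda>zs M'. has_vals M' zs (map2 (\<lambda>u v. u + c * v) us vs))"
  unfolding add_multiple_def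
proof (rule wp_map_prog[OF list_all2_zip_has_vals[OF assms(2,3)]])
  fix x v M'
  assume "(case x of (x, y) \<Rightarrow> \<lambda>(u, v). has_val M x u \<and> has_val M y v) v" and M': "prefix M M'"
  then obtain y z u w where x: "x = (y, z)" "v = (u, w)" "has_val M y u" "has_val M z w"
    by (auto split: prod.splits)
  have "wp M' (instr (Mul a z)) (\<lambda>t M''. has_val M'' t (c * w))"
    using x M' assms by (intro wp_Mul) (auto intro: has_prefix)
  then have "wp M' (bind_prog (instr (Mul a z)) (\<lambda>t. instr (Add y t))) (\<lambda>t M''. has_val M'' t (u + c * w))"
    by (rule wp_bind) (use x M' in \<open>auto intro!: wp_Add intro: has_prefix prefix_order.trans\<close>)
  with x show "wp M' (case x of (x, y) \<Rightarrow> bind_prog (instr (Mul a y)) (\<lambda>t. instr (Add x t)))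
     (\<lambda>t M''. has_val M'' t (case v of (u, v) \<Rightarrow> u + c * v))"
    by simp
qed (rule has_val_prefix)

lemma fold_add_eq_sum_list:
  fixes t :: "'a::comm_monoid_add"
  shows "fold (\<lambda>x s. s + f x) xs t = t + sum_list (map f xs)"
  by (induction xs arbitrary: t) (simp_all add: add.assoc)

lemma wp_inner_prod:
  assumes "has_val M z 0" "has_vals M xs us" "has_vals M ys vs" "length us = k" "length vs = k"
  shows "wp M (inner_prod z xs ys) (\<lambda>a M'. has_val M' a (\<Sum>i<k. us ! i * vs ! i))"
proof -
  have "fold (\<lambda>(u, v) s. s + u * v) (zip us vs) 0 = (\<Sum>i<k. us ! i * vs ! i)"
    using assms(4,5) fold_add_eq_sum_list[of "\<lambda>(u, v). u * v" "zip us vs" 0]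
    by (simp add: sum_list_sum_nth case_prod_beta' atLeast0LessThan)
  moreover have "wp M (inner_prod z xs ys)
      (\<lambda>a M'. has_val M' a (fold (\<lambda>(u, v) s. s + u * v) (zip us vs) 0))"
    unfolding inner_prod_def
  proof (rule wp_fold_prog[OF list_all2_zip_has_vals[OF assms(2,3)], where S = has_val])
    fix x v s t M'
    assume "(case x of (x, y) \<Rightarrow> \<lambda>(u, v). has_val M x u \<and> has_val M y v) v"
      and M': "prefix M M'" "has_val M' s t"
    then obtain y z u w where x: "x = (y, z)" "v = (u, w)" "has_val M y u" "has_val M z w"
      by (auto split: prod.splits)
    have "wp M' (instr (Mul y z)) (\<lambda>t M''. has_val M'' t (u * w))"
      using x M' by (intro wp_Mul) (auto intro: has_prefix)
    then have "wp M' (bind_prog (instr (Mul y z)) (\<lambda>t. instr (Add s t))) (\<lambda>a M''. has_val M'' a (t + u * w))"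
      by (rule wp_bind) (use x M' in \<open>auto intro!: wp_Add intro: has_prefix prefix_order.trans\<close>)
    with x show "wp M' ((case x of (x, y) \<Rightarrow> \<lambda>s. bind_prog (instr (Mul x y)) (\<lambda>t. instr (Add s t))) s)
       (\<lambda>a M''. has_val M'' a ((case v of (u, v) \<Rightarrow> \<lambda>s. s + u * v) t))"
      by simp
  qed (rule assms(1))
  ultimately show ?thesis
    by simp
qed

lemma wp_mat_vec_mult:
  assumes "has_val M z 0" "has_rows M A V" "has_vals M xs us" "\<forall>v\<in>set V. length v = k" "length us = k"
  shows "wp M (mat_vec_mult z A xs) (\<lambda>ys M'. has_vals M' ys (map (\<lambda>v. \<Sum>i<k. v ! i * us ! i) V))"
  unfolding mat_vec_mult_def
proof (rule wp_map_prog)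
  show "list_all2 (\<lambda>r v. has_vals M r v \<and> length v = k) A V"
    using assms(2,4) by (auto simp: list_all2_conv_all_nth)
qed (use assms in \<open>auto intro: wp_inner_prod has_prefix\<close>)

subsection \<open>Matrix inversion\<close>

text \<open>The invariant of Gauss-Jordan elimination on the rows \<open>(A | I)\<close> after \<open>c\<close> columns. Every row
  \<open>(x | y)\<close> satisfies \<open>x = y A\<close>, so that \<open>y\<close> is a row of the inverse once \<open>x\<close> is a row of \<open>I\<close>. By the
  last condition a missing pivot yields a vector in the kernel of \<open>A\<close>.\<close>
definition gauss_jordan_inv ::
    "nat \<Rightarrow> (nat \<Rightarrow> nat \<Rightarrow> 'f::field) \<Rightarrow> nat \<Rightarrow> 'f list list \<Rightarrow> 'f list list \<Rightarrow> bool" where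
  "gauss_jordan_inv k A c P R \<longleftrightarrow>
     length P = c \<and> length P + length R = k \<and>
     (\<forall>r\<in>set P \<union> set R. length r = 2 * k \<and> (\<forall>j<k. r ! j = (\<Sum>i<k. r ! (k + i) * A i j))) \<and>
     (\<forall>i<c. \<forall>j<c. P ! i ! j = of_bool (i = j)) \<and>
     (\<forall>r\<in>set R. \<forall>j<c. r ! j = 0) \<and>
     (\<forall>x. (\<forall>r\<in>set P \<union> set R. (\<Sum>j<k. r ! j * x j) = 0) \<longrightarrow> (\<forall>i<k. (\<Sum>j<k. A i j * x j) = 0))"

text \<open>If column \<open>c\<close> vanished on all remaining rows, it would be a free column
  with the usual kernel vector: minus column \<open>c\<close> of the pivot rows, then 1 at position
  \<open>c\<close>, then zeros. The last clause of the invariant carries this vector into the kernel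
  of \<open>A\<close>, against injectivity.\<close>

lemma gauss_jordan_inv_pivot:
  assumes inv: "gauss_jordan_inv k A c P R" and "c < k"
    and inj: "\<And>x. (\<forall>i<k. (\<Sum>j<k. A i j * x j) = 0) \<Longrightarrow> \<forall>j<k. x j = 0"
  shows "\<exists>r\<in>set R. r ! c \<noteq> 0"
proof (rule ccontr)
  assume "\<not> (\<exists>r\<in>set R. r ! c \<noteq> 0)"
  then have R: "\<forall>r\<in>set R. \<forall>j<Suc c. r ! j = 0"
    using inv by (auto simp: gauss_jordan_inv_def less_Suc_eq)
  define x where "x j = (if j < c then - P ! j ! c else if j = c then 1 else 0)" for j
  have split: "(\<Sum>j<k. r ! j * x j) = (\<Sum>j<c. r ! j * x j) + r ! c" for r
  proof -
    have "(\<Sum>j<k. r ! j * x j) = (\<Sum>j<Suc c. r ! j * x j)"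
      using \<open>c < k\<close> by (intro sum.mono_neutral_right) (auto simp: x_def)
    then show ?thesis
      by (simp add: x_def)
  qed
  have "(\<Sum>j<k. r ! j * x j) = 0" if "r \<in> set P \<union> set R" for r
  proof (cases "r \<in> set R")
    case True
    with R show ?thesis
      unfolding split by simp
  next
    case False
    with that inv obtain i where i: "i < c" "r = P ! i"
      by (auto simp: gauss_jordan_inv_def set_conv_nth)
    have "(\<Sum>j<c. r ! j * x j) = (\<Sum>j<c. if j = i then - P ! i ! c else 0)"
      using inv i by (intro sum.cong) (auto simp: gauss_jordan_inv_def x_def)
    with i show ?thesis
      unfolding split by simp
  qed
  then have "\<forall>i<k. (\<Sum>j<k. A i j * x j) = 0"
    using inv by (auto simp: gauss_jordan_inv_def)
  then have "x c = 0"
    using inj \<open>c < k\<close> by blast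
  then show False
    by (simp add: x_def)
qed

text \<open>Both halves of a row undergo the same operations, which preserves
  \<open>x = y A\<close>. The kernel clause needs the converse direction, that the row operations
  can be undone: \<open>r\<close> is \<open>elim r\<close> plus \<open>r ! c\<close> times
  \<open>piv'\<close>, and \<open>piv\<close> is \<open>piv ! c\<close> times
  \<open>piv'\<close>.\<close>

lemma gauss_jordan_inv_step:
  assumes inv: "gauss_jordan_inv k A c P R" and "c < k"
    and R: "set R = insert piv (set rest)" "length R = Suc (length rest)" and piv: "piv ! c \<noteq> 0"
    and piv': "piv' = map (\<lambda>x. x / piv ! c) piv"
    and elim: "\<And>r. elim r = map2 (\<lambda>u v. u - r ! c * v) r piv'"
  shows "gauss_jordan_inv k A (Suc c) (map elim P @ [piv']) (map elim rest)"
proof -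
  have len: "length r = 2 * k" if "r \<in> set P \<union> set R" for r
    using inv that by (auto simp: gauss_jordan_inv_def)
  have piv_R: "piv \<in> set R" "set rest \<subseteq> set R"
    using R by auto
  have piv'_nth: "piv' ! j = piv ! j / piv ! c" if "j < 2 * k" for j
    using that len piv_R by (simp add: piv')
  have len_piv': "length piv' = 2 * k"
    using len piv_R by (simp add: piv')
  have elim_nth: "elim r ! j = r ! j - r ! c * piv' ! j" if "r \<in> set P \<union> set R" "j < 2 * k" for r j
    using that len len_piv' by (simp add: elim)
  have len_elim: "length (elim r) = 2 * k" if "r \<in> set P \<union> set R" for r
    using that len len_piv' by (simp add: elim)
  have lin: "r ! j = (\<Sum>i<k. r ! (k + i) * A i j)" if "r \<in> set P \<union> set R" "j < k" for r j
    using inv that unfolding gauss_jordan_inv_def by blast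
  have lin_piv': "piv' ! j = (\<Sum>i<k. piv' ! (k + i) * A i j)" if "j < k" for j
  proof -
    have "piv' ! j = (\<Sum>i<k. piv ! (k + i) * A i j) / piv ! c"
      using that lin[of piv j] piv_R by (simp add: piv'_nth)
    then show ?thesis
      by (simp add: piv'_nth sum_divide_distrib)
  qed
  have lin_elim: "elim r ! j = (\<Sum>i<k. elim r ! (k + i) * A i j)"
    if "r \<in> set P \<union> set R" "j < k" for r j
  proof -
    have "elim r ! j = (\<Sum>i<k. r ! (k + i) * A i j) - r ! c * (\<Sum>i<k. piv' ! (k + i) * A i j)"
      using that lin[OF that] lin_piv'[OF that(2)] by (simp add: elim_nth)
    also have "\<dots> = (\<Sum>i<k. elim r ! (k + i) * A i j)"
      using that by (simp add: elim_nth sum_distrib_left sum_subtractf algebra_simps)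
    finally show ?thesis .
  qed
  have piv'_low: "piv' ! j = of_bool (j = c)" if "j < Suc c" for j
    using inv that piv piv_R \<open>c < k\<close> by (auto simp: gauss_jordan_inv_def piv'_nth less_Suc_eq)
  have kernel: "\<forall>i<k. (\<Sum>j<k. A i j * x j) = 0"
    if x: "\<forall>r\<in>set (map elim P @ [piv']) \<union> set (map elim rest). (\<Sum>j<k. r ! j * x j) = 0" for x
  proof -
    have piv'_x: "(\<Sum>j<k. piv' ! j * x j) = 0"
      using x by simp
    have "(\<Sum>j<k. r ! j * x j) = 0" if r: "r \<in> set P \<union> set R" for r
    proof (cases "r \<in> set P \<union> set rest")
      case True
      then have "(\<Sum>j<k. elim r ! j * x j) = 0"
        using x by auto
      moreover have "(\<Sum>j<k. elim r ! j * x j) = (\<Sum>j<k. r ! j * x j) - r ! c * (\<Sum>j<k. piv' ! j * x j)"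
        using r by (simp add: elim_nth sum_distrib_left sum_subtractf algebra_simps)
      ultimately show ?thesis
        using piv'_x by simp
    next
      case False
      with r R have "r = piv"
        by auto
      then have "(\<Sum>j<k. r ! j * x j) = piv ! c * (\<Sum>j<k. piv' ! j * x j)"
        using piv by (simp add: piv'_nth sum_distrib_left)
      with piv'_x show ?thesis
        by simp
    qed
    with inv show ?thesis
      unfolding gauss_jordan_inv_def by blast
  qed
  have lenP: "length P = c" "c + length R = k"
    using inv by (auto simp: gauss_jordan_inv_def)
  have "(map elim P @ [piv']) ! i ! j = of_bool (i = j)" if ij: "i < Suc c" "j < Suc c" for i j
  proof (cases "i = c")
    case True
    with ij lenP show ?thesis
      by (auto simp: nth_append piv'_low)
  next
    case False
    then have "i < c"
      using ij by simp
    then have "(map elim P @ [piv']) ! i ! j = P ! i ! j - P ! i ! c * of_bool (j = c)"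
      using ij lenP \<open>c < k\<close> by (simp add: nth_append elim_nth piv'_low)
    with ij \<open>i < c\<close> inv show ?thesis
      by (cases "j = c") (auto simp: gauss_jordan_inv_def)
  qed
  moreover have "r ! j = 0" if rj: "r \<in> set (map elim rest)" "j < Suc c" for r j
  proof -
    obtain q where q: "q \<in> set rest" "r = elim q"
      using rj by auto
    with rj piv_R \<open>c < k\<close> have "r ! j = q ! j - q ! c * of_bool (j = c)"
      by (auto simp: elim_nth piv'_low)
    with q rj piv_R inv show ?thesis
      by (cases "j = c") (auto simp: gauss_jordan_inv_def)
  qed
  ultimately show ?thesis
    unfolding gauss_jordan_inv_def
    using kernel len_elim len_piv' lin_elim lin_piv' R piv_R lenP by auto
qed

text \<open>At \<open>c = k\<close> the left halves of the rows form the identity, so by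
  \<open>x = y A\<close> the right halves form a left inverse of \<open>A\<close>. Injectivity
  excludes the branch without a pivot.\<close>

lemma wp_gauss_jordan:
  assumes inj: "\<And>x. (\<forall>i<k. (\<Sum>j<k. A i j * x j) = 0) \<Longrightarrow> \<forall>j<k. x j = 0"
    and "has_rows M pivs P" "has_rows M rs R" "gauss_jordan_inv k A c P R" "c \<le> k"
  shows "wp M (gauss_jordan [c..<k] pivs rs) (\<lambda>N M'. \<exists>V. has_rows M' N V \<and> gauss_jordan_inv k A k V [])"
  using assms(2-5)
proof (induction "[c..<k]" arbitrary: M c pivs rs P R)
  case Nil
  then have "k \<le> c"
    by (metis upt_eq_Nil_conv le_0_eq)
  moreover from Nil.prems have "length P = c" "length P + length R = k"
    by (auto simp only: gauss_jordan_inv_def)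
  ultimately have "c = k" "R = []"
    by auto
  with Nil.prems show ?case
    by auto
next
  case (Cons c' cs)
  have c: "c < k" "c' = c" "cs = [Suc c..<k]"
    using Cons.hyps(2)[symmetric] by (auto simp: upt_eq_Cons_conv)
  note inv = \<open>gauss_jordan_inv k A c P R\<close>
  have lens: "\<forall>v\<in>set P \<union> set R. c < length v"
    using inv c by (auto simp: gauss_jordan_inv_def)
  show ?case
    unfolding \<open>c' # cs = [c..<k]\<close>[symmetric] gauss_jordan.simps
  proof (rule wp_bind[OF wp_extract_pivot[OF \<open>has_rows M rs R\<close>]], goal_cases)
    case 1
    with lens c show ?case by simp
  next
    case (2 res M0)
    show ?case
    proof (cases res)
      case None
      with 2 c have "\<forall>r\<in>set R. r ! c = 0"
        by simp
      with gauss_jordan_inv_pivot[OF inv c(1) inj] show ?thesis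
        by blast
    next
      case (Some pr)
      obtain piv rest where pr: "pr = (piv, rest)"
        by force
      with 2 Some c obtain pivV restV where M0: "M0 = M" and
        piv: "has_vals M piv pivV" "has_rows M rest restV" "pivV ! c \<noteq> 0"
          "set R = insert pivV (set restV)" "length R = Suc (length restV)"
        by auto
      define piv'V where "piv'V = map (\<lambda>x. x / pivV ! c) pivV"
      define elim where "elim r = map2 (\<lambda>u v. u - r ! c * v) r piv'V" for r
      \<comment> \<open>Three memories are distinguished because the fact is used twice: the rows
        are known in \<open>M\<close>, the scaled pivot row exists from \<open>M1\<close> on, and
        the elimination itself starts in some later \<open>M2\<close>.\<close>
      have eliminate: "wp M2 (map_prog (\<lambda>r. sub_multiple (r ! c) r piv') ys)
          (\<lambda>zs M3. has_rows M3 zs (map elim V))"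
        if "has_rows M ys V" "has_vals M1 piv' piv'V" "prefix M M1" "prefix M1 M2"
          "set V \<subseteq> set P \<union> set R" for M1 M2 piv' ys V
      proof (rule wp_map_prog)
        have "\<forall>v\<in>set V. c < length v"
          using that(5) lens by auto
        with that(1) show "list_all2 (\<lambda>r v. has_vals M r v \<and> c < length v) ys V"
          by (auto simp: list_all2_conv_all_nth)
        fix r v M3 assume r: "has_vals M r v \<and> c < length v" and M3: "prefix M2 M3"
        from that M3 have "prefix M M3" "prefix M1 M3"
          by auto
        with r that show "wp M3 (sub_multiple (r ! c) r piv') (\<lambda>zs M'. has_vals M' zs (elim v))"
          unfolding elim_def by (intro wp_sub_multiple) (auto intro: has_prefix has_vals_nth)
      qed (rule has_vals_prefix)
      have "wp M (map_prog (\<lambda>x. instr (Div x (piv ! c))) piv) (\<lambda>piv' M1. has_vals M1 piv' piv'V)"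
        unfolding piv'V_def
      proof (rule wp_map_prog[OF piv(1)])
        have "c < length pivV"
          using lens piv by simp
        then show "wp M' (instr (Div x (piv ! c))) (\<lambda>a M''. has_val M'' a (v / pivV ! c))"
          if "has_val M x v" "prefix M M'" for x v M'
          using that piv by (intro wp_Div) (auto intro: has_prefix has_vals_nth)
      qed (rule has_val_prefix)
      then have "wp M (bind_prog (map_prog (\<lambda>x. instr (Div x (piv ! c))) piv) (\<lambda>piv'.
          bind_prog (map_prog (\<lambda>r. sub_multiple (r ! c) r piv') pivs) (\<lambda>pivs'.
          bind_prog (map_prog (\<lambda>r. sub_multiple (r ! c) r piv') rest) (\<lambda>rest'.
          gauss_jordan cs (pivs' @ [piv']) rest'))))
        (\<lambda>N M'. \<exists>V. has_rows M' N V \<and> gauss_jordan_inv k A k V [])"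
      proof (rule wp_bind)
        fix piv' M1 assume M1: "prefix M M1" "has_vals M1 piv' piv'V"
        show "wp M1 (bind_prog (map_prog (\<lambda>r. sub_multiple (r ! c) r piv') pivs) (\<lambda>pivs'.
          bind_prog (map_prog (\<lambda>r. sub_multiple (r ! c) r piv') rest) (\<lambda>rest'.
          gauss_jordan cs (pivs' @ [piv']) rest')))
        (\<lambda>N M'. \<exists>V. has_rows M' N V \<and> gauss_jordan_inv k A k V [])"
        proof (rule wp_bind[OF eliminate[OF \<open>has_rows M pivs P\<close> M1(2,1)]])
          fix pivs' M2 assume M2: "prefix M1 M2" "has_rows M2 pivs' (map elim P)"
          show "wp M2 (bind_prog (map_prog (\<lambda>r. sub_multiple (r ! c) r piv') rest) (\<lambda>rest'.
              gauss_jordan cs (pivs' @ [piv']) rest'))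
            (\<lambda>N M'. \<exists>V. has_rows M' N V \<and> gauss_jordan_inv k A k V [])"
          proof (rule wp_bind[OF eliminate[OF piv(2) M1(2,1) M2(1)]])
            fix rest' M3 assume M3: "prefix M2 M3" "has_rows M3 rest' (map elim restV)"
            have "has_rows M3 (pivs' @ [piv']) (map elim P @ [piv'V])"
              using M1 M2 M3 by (auto intro!: list_all2_appendI intro: has_prefix prefix_order.trans)
            then show "wp M3 (gauss_jordan cs (pivs' @ [piv']) rest')
                (\<lambda>N M'. \<exists>V. has_rows M' N V \<and> gauss_jordan_inv k A k V [])"
              unfolding c(3)
              using M3(2) gauss_jordan_inv_step[OF inv c(1) piv(4,5,3) piv'V_def elim_def] c
              by (intro Cons.hyps(1)) auto
          qed (use piv in auto)
        qed auto
      qed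
      with Some pr M0 c show ?thesis
        by simp
    qed
  qed
qed

text \<open>Regularity is assumed as a trivial kernel, the form in which both uses supply it: a
  received block and the matrix of a multiplication in the extension field. Elimination gives a left
  inverse; the other side is recovered separately.\<close>

lemma wp_mat_inv:
  fixes V :: "'f::field list list"
  assumes "has_val M z 0" "has_val M e 1" "has_rows M A V" "length V = k" "\<forall>v\<in>set V. length v = k"
    and inj: "\<And>x. (\<forall>i<k. (\<Sum>j<k. V ! i ! j * x j) = 0) \<Longrightarrow> \<forall>j<k. x j = 0"
  shows "wp M (mat_inv z e k A) (\<lambda>N M'. \<exists>W. has_rows M' N W \<and> length W = k \<and>
     (\<forall>w\<in>set W. length w = k) \<and>
     (\<forall>i<k. \<forall>j<k. (\<Sum>l<k. W ! i ! l * V ! l ! j) = of_bool (i = j)))"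
proof -
  let ?AI = "map (\<lambda>i. A ! i @ map (\<lambda>j. if i = j then e else z) [0..<k]) [0..<k]"
  define VI where "VI = map (\<lambda>i. V ! i @ map (\<lambda>j. of_bool (i = j)) [0..<k]) [0..<k]"
  have "has_rows M ?AI VI"
    using assms unfolding VI_def
    by (auto simp: list_all2_conv_all_nth nth_append)
  moreover have "gauss_jordan_inv k (\<lambda>i j. V ! i ! j) 0 [] VI"
  proof -
    have "length VI = k"
      by (simp add: VI_def)
    have VI: "length (VI ! i) = 2 * k" "j < k \<Longrightarrow> VI ! i ! j = V ! i ! j"
      "j < k \<Longrightarrow> VI ! i ! (k + j) = of_bool (i = j)" if "i < k" for i j
      using that assms(4,5) by (simp_all add: VI_def nth_append)
    have "VI ! i ! j = (\<Sum>l<k. VI ! i ! (k + l) * V ! l ! j)" if "i < k" "j < k" for i j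
    proof -
      have "(\<Sum>l<k. VI ! i ! (k + l) * V ! l ! j) = (\<Sum>l<k. if l = i then V ! i ! j else 0)"
        using that by (intro sum.cong) (auto simp: VI)
      then show ?thesis
        using that by (simp add: VI)
    qed
    moreover have "\<forall>i<k. (\<Sum>j<k. V ! i ! j * x j) = 0"
      if "\<forall>r\<in>set VI. (\<Sum>j<k. r ! j * x j) = 0" for x
    proof (intro allI impI)
      fix i assume "i < k"
      then have "VI ! i \<in> set VI"
        using \<open>length VI = k\<close> by simp
      with that have "(\<Sum>j<k. VI ! i ! j * x j) = 0"
        by blast
      with \<open>i < k\<close> show "(\<Sum>j<k. V ! i ! j * x j) = 0"
        by (simp add: VI)
    qed
    ultimately show ?thesis
      unfolding gauss_jordan_inv_def using VI(1) \<open>length VI = k\<close> by (auto simp: in_set_conv_nth)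
  qed
  ultimately have "wp M (gauss_jordan [0..<k] [] ?AI)
      (\<lambda>N M'. \<exists>W. has_rows M' N W \<and> gauss_jordan_inv k (\<lambda>i j. V ! i ! j) k W [])"
    by (intro wp_gauss_jordan[OF inj]) auto
  then show ?thesis
    unfolding mat_inv_def
  proof (rule wp_bind)
    fix N M' assume "\<exists>W. has_rows M' N W \<and> gauss_jordan_inv k (\<lambda>i j. V ! i ! j) k W []"
    then obtain W where W: "has_rows M' N W" "gauss_jordan_inv k (\<lambda>i j. V ! i ! j) k W []"
      by blast
    have "has_rows M' (map (drop k) N) (map (drop k) W)"
      using W(1) by (auto simp: list_all2_conv_all_nth)
    moreover have "(\<Sum>l<k. map (drop k) W ! i ! l * V ! l ! j) = of_bool (i = j)"
      if ij: "i < k" "j < k" for i j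
    proof -
      have len: "length W = k"
        using W(2) by (simp add: gauss_jordan_inv_def)
      with ij have "W ! i \<in> set W"
        by simp
      then have "length (W ! i) = 2 * k" "W ! i ! j = (\<Sum>l<k. W ! i ! (k + l) * V ! l ! j)"
        "W ! i ! j = of_bool (i = j)"
        using W(2) ij unfolding gauss_jordan_inv_def by blast+
      with len ij show ?thesis
        by simp
    qed
    ultimately show "wp M' (Return (map (drop k) N)) (\<lambda>N M'. \<exists>W. has_rows M' N W \<and> length W = k \<and>
       (\<forall>w\<in>set W. length w = k) \<and>
       (\<forall>i<k. \<forall>j<k. (\<Sum>l<k. W ! i ! l * V ! l ! j) = of_bool (i = j)))"
      using W(2) by (auto simp: gauss_jordan_inv_def intro!: exI[of _ "map (drop k) W"])
  qed
qed

section \<open>Arithmetic in the extension field\<close>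

text \<open>Elimination yields \<open>W C = I\<close>, but reading off a solution of
  \<open>C y = e_0\<close> from the first column of \<open>W\<close> requires
  \<open>C W = I\<close>.\<close>

lemma left_inverse_imp_right_inverse:
  fixes A B :: "nat \<Rightarrow> nat \<Rightarrow> 'a::field"
  assumes "\<forall>i<k. \<forall>j<k. (\<Sum>l<k. A i l * B l j) = of_bool (i = j)"
  shows "\<forall>i<k. \<forall>j<k. (\<Sum>l<k. B i l * A l j) = of_bool (i = j)"
proof -
  let ?A = "mat k k (\<lambda>(i, j). A i j)" and ?B = "mat k k (\<lambda>(i, j). B i j)"
  have "?A * ?B = 1\<^sub>m k"
    using assms by (intro eq_matI) (auto simp: scalar_prod_def atLeast0LessThan)
  then have "?B * ?A = 1\<^sub>m k"
    by (intro mat_mult_left_right_inverse[where A = ?A]) simp_all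
  then have "(?B * ?A) $$ (i, j) = of_bool (i = j)" if "i < k" "j < k" for i j
    using that by simp
  then show ?thesis
    by (simp add: scalar_prod_def atLeast0LessThan)
qed

text \<open>Coordinates are lists, lowest power first, with \<open>horner_sum\<close> as evaluation
  at \<alpha>. Monicity of the polynomial enters the arithmetic as \<open>root\<close>;
  irreducibility enters as \<open>k_pos\<close> and \<open>independent\<close>.\<close>

locale simple_extension = field_hom \<iota>
  for \<iota> :: "'f::field \<Rightarrow> 'e::field" +
  fixes \<alpha> :: 'e and pv :: "'f list" and k :: nat
  assumes length_pv: "length pv = k" and k_pos: "0 < k"
    and root: "\<alpha> ^ k = - horner_sum \<iota> \<alpha> pv"
    and independent: "\<And>xs. length xs = k \<Longrightarrow> horner_sum \<iota> \<alpha> xs = 0 \<Longrightarrow> xs = replicate k 0"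
begin

abbreviation ev :: "'f list \<Rightarrow> 'e" where
  "ev \<equiv> horner_sum \<iota> \<alpha>"

definition represents :: "'f option list \<Rightarrow> addr list \<Rightarrow> 'e \<Rightarrow> bool" where
  "represents M xs x \<longleftrightarrow> (\<exists>vs. has_vals M xs vs \<and> length vs = k \<and> ev vs = x)"

lemma representsI: "has_vals M xs vs \<Longrightarrow> length vs = k \<Longrightarrow> ev vs = x \<Longrightarrow> represents M xs x"
  by (auto simp: represents_def)

lemma represents_prefix: "prefix M M' \<Longrightarrow> represents M xs x \<Longrightarrow> represents M' xs x"
  by (auto simp: represents_def intro: has_prefix)

lemma wp_representsI:
  "wp M p (\<lambda>xs M'. has_vals M' xs vs) \<Longrightarrow> length vs = k \<Longrightarrow> ev vs = x \<Longrightarrow>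
   wp M p (\<lambda>xs M'. represents M' xs x)"
  by (erule wp_mono) (rule representsI)

lemma ev_replicate_0 [simp]: "ev (replicate n 0) = 0"
  by (induction n) auto

lemma ev_diff_multiple:
  "length us = length vs \<Longrightarrow> ev (map2 (\<lambda>u v. u - c * v) us vs) = ev us - \<iota> c * ev vs"
proof (induction us vs rule: list_induct2)
  case (Cons u us v vs)
  show ?case
    by (simp only: zip_Cons_Cons list.map case_prod_conv horner_sum_simps Cons.IH hom_mult hom_minus)
      (simp add: algebra_simps)
qed simp

lemma ev_add_multiple:
  "length us = length vs \<Longrightarrow> ev (map2 (\<lambda>u v. u + c * v) us vs) = ev us + \<iota> c * ev vs"
proof (induction us vs rule: list_induct2)
  case (Cons u us v vs)
  show ?case
    by (simp only: zip_Cons_Cons list.map case_prod_conv horner_sum_simps Cons.IH hom_mult hom_add)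
      (simp add: algebra_simps)
qed simp

lemma ev_map_upt: "ev (map x [0..<n]) = (\<Sum>i<n. \<iota> (x i) * \<alpha> ^ i)"
  by (simp add: horner_sum_eq_sum atLeast0LessThan)

lemma ev_linear_combination:
  assumes "\<And>j. j < n \<Longrightarrow> length (V ! j) = k"
  shows "ev (map (\<lambda>i. \<Sum>j<n. V ! j ! i * x j) [0..<k]) = (\<Sum>j<n. ev (V ! j) * \<iota> (x j))"
proof -
  have "ev (map (\<lambda>i. \<Sum>j<n. V ! j ! i * x j) [0..<k]) =
      (\<Sum>i<k. \<Sum>j<n. \<iota> (V ! j ! i) * \<iota> (x j) * \<alpha> ^ i)"
    by (simp add: ev_map_upt hom_distribs sum_distrib_right)
  also have "\<dots> = (\<Sum>j<n. \<Sum>i<k. \<iota> (V ! j ! i) * \<iota> (x j) * \<alpha> ^ i)"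
    by (rule sum.swap)
  also have "\<dots> = (\<Sum>j<n. ev (V ! j) * \<iota> (x j))"
    using assms by (intro sum.cong) (auto simp: horner_sum_eq_sum sum_distrib_right intro!: sum.cong)
  finally show ?thesis .
qed

lemma mult_power_minus_1: "\<alpha> * \<alpha> ^ (k - 1) = \<alpha> ^ k"
  using k_pos by (metis power_minus_mult mult.commute)

text \<open>If \<alpha> were 0, the coordinates \<open>0, 1, 0, ..., 0\<close> would give a
  relation, which needs room for two entries. If the constant coefficient were 0, then
  \<open>qs @ [1]\<close>, the coefficients of \<open>p / x\<close>, would give one after cancelling
  \<alpha>.\<close>

lemma nonzero_if_degree_gt_1:
  assumes "1 < k"
  shows "\<alpha> \<noteq> 0" "hd pv \<noteq> 0"
proof -
  show \<alpha>: "\<alpha> \<noteq> 0"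
  proof
    assume "\<alpha> = 0"
    have "k = Suc (Suc (k - 2))"
      using assms by simp
    then obtain n where "k = Suc (Suc n)" ..
    moreover have "ev (0 # 1 # replicate n 0) = 0"
      using \<open>\<alpha> = 0\<close> by simp
    ultimately show False
      using independent[of "0 # 1 # replicate n 0"] by simp
  qed
  show "hd pv \<noteq> 0"
  proof
    assume "hd pv = 0"
    then obtain qs where pv: "pv = 0 # qs" "length qs = k - 1"
      using length_pv k_pos by (cases pv) auto
    have "ev (qs @ [1]) = ev qs + \<alpha> ^ (k - 1)"
      using pv by (simp add: horner_sum_append)
    moreover have "ev pv = \<alpha> * ev qs"
      using pv by simp
    ultimately have "\<alpha> * ev (qs @ [1]) = ev pv + \<alpha> ^ k"
      by (simp add: distrib_left mult_power_minus_1 del: One_nat_def)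
    then have "ev (qs @ [1]) = 0"
      using root \<alpha> by simp
    then have "last (qs @ [1]) = last (replicate k 0)"
      using independent[of "qs @ [1]"] pv k_pos by simp
    with k_pos show False
      by simp
  qed
qed

text \<open>After shifting the coordinates up, the last one, \<open>u\<close>, overflows to
  \<open>u\<close> times \<open>\<alpha> ^ k\<close>. The relation \<open>root\<close> turns this
  into a subtraction of \<open>u\<close> times the coefficients of the polynomial.\<close>

lemma wp_times_alpha:
  assumes "has_val M z 0" "has_vals M ps pv" "represents M xs x"
  shows "wp M (times_alpha z ps xs) (\<lambda>ys M'. represents M' ys (\<alpha> * x))"
proof -
  obtain us where us: "has_vals M xs us" "length us = k" "ev us = x"
    using assms by (auto simp: represents_def)
  obtain us' u where u: "us = us' @ [u]"
    using us k_pos by (cases us rule: rev_cases) auto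
  with us obtain xs' l where l: "xs = xs' @ [l]" "has_vals M xs' us'" "has_val M l u"
    by (auto simp: list_all2_append2 list_all2_Cons2)
  have "wp M (sub_multiple (last xs) (z # butlast xs) ps)
      (\<lambda>zs M'. has_vals M' zs (map2 (\<lambda>v w. v - u * w) (0 # us') pv))"
    by (rule wp_sub_multiple) (use l assms in auto)
  moreover have "ev (map2 (\<lambda>v w. v - u * w) (0 # us') pv) = \<alpha> * x"
  proof -
    have "ev (map2 (\<lambda>v w. v - u * w) (0 # us') pv) = \<alpha> * ev us' - \<iota> u * ev pv"
      using us u length_pv by (subst ev_diff_multiple) auto
    also have "\<dots> = \<alpha> * ev us' + \<iota> u * \<alpha> ^ k"
      using root by simp
    also have "\<dots> = \<alpha> * ev us"
      using us u by (auto simp: horner_sum_append algebra_simps)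
    finally show ?thesis
      using us by simp
  qed
  moreover have "length (map2 (\<lambda>v w. v - u * w) (0 # us') pv) = k"
    using us u length_pv by simp
  ultimately show ?thesis
    unfolding times_alpha_def by (intro wp_representsI)
qed

lemma wp_div_alpha:
  assumes "has_val M z 0" "has_vals M ps pv" "represents M xs (\<alpha> * x)" "\<alpha> \<noteq> 0" "hd pv \<noteq> 0"
  shows "wp M (div_alpha z ps xs) (\<lambda>ys M'. represents M' ys x)"
proof -
  obtain us where us: "has_vals M xs us" "length us = k" "ev us = \<alpha> * x"
    using assms by (auto simp: represents_def)
  obtain u us' where u: "us = u # us'"
    using us k_pos by (cases us) auto
  with us obtain l xs' where l: "xs = l # xs'" "has_val M l u" "has_vals M xs' us'"
    by (auto simp: list_all2_Cons2)
  obtain p0 pv' where p: "pv = p0 # pv'"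
    using length_pv k_pos by (cases pv) auto
  with assms(2) obtain q ps' where q: "ps = q # ps'" "has_val M q p0" "has_vals M ps' pv'"
    by (auto simp: list_all2_Cons2)
  have lens: "length us' = k - 1" "length pv' = k - 1"
    using us u p length_pv by auto
  define c where "c = u / p0"
  let ?vs = "map2 (\<lambda>v w. v - c * w) us' pv'"
  have "wp M (instr (Div (hd xs) (hd ps))) (\<lambda>t M'. has_val M' t c)"
    unfolding c_def by (rule wp_Div) (use l q p assms in auto)
  then have "wp M (div_alpha z ps xs) (\<lambda>ys M'. has_vals M' ys (?vs @ [0 - c]))"
    unfolding div_alpha_def
  proof (rule wp_bind)
    fix t M1 assume M1: "prefix M M1" "has_val M1 t c"
    have "wp M1 (sub_multiple t (tl xs) (tl ps)) (\<lambda>ys M'. has_vals M' ys ?vs)"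
      by (rule wp_sub_multiple) (use M1 l q in \<open>auto intro: has_prefix\<close>)
    then show "wp M1 (bind_prog (sub_multiple t (tl xs) (tl ps)) (\<lambda>ys.
        bind_prog (instr (Sub z t)) (\<lambda>y. Return (ys @ [y]))))
      (\<lambda>ys M'. has_vals M' ys (?vs @ [0 - c]))"
    proof (rule wp_bind)
      fix ys M2 assume M2: "prefix M1 M2" "has_vals M2 ys ?vs"
      have "wp M2 (instr (Sub z t)) (\<lambda>y M'. has_val M' y (0 - c))"
        by (rule wp_Sub) (use M1 M2 assms in \<open>auto intro: has_prefix\<close>)
      then show "wp M2 (bind_prog (instr (Sub z t)) (\<lambda>y. Return (ys @ [y])))
          (\<lambda>ys M'. has_vals M' ys (?vs @ [0 - c]))"
        by (rule wp_bind) (use M2 in \<open>auto intro!: list_all2_appendI intro: has_prefix\<close>)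
    qed
  qed
  \<comment> \<open>The equation is verified after multiplication by \<alpha>, which can be
    cancelled. The new top coordinate \<open>- c\<close> then produces \<open>- c\<close> times
    \<open>\<alpha> ^ k\<close>; together with the part coming from \<open>pv'\<close> this leaves
    \<open>c * p0\<close>, which is the dropped coordinate \<open>u\<close>.\<close>
  moreover have "ev (?vs @ [0 - c]) = x"
  proof -
    have "ev ?vs = ev us' - \<iota> c * ev pv'"
      using lens by (intro ev_diff_multiple) simp
    then have "ev (?vs @ [0 - c]) = ev us' - \<iota> c * ev pv' - \<alpha> ^ (k - 1) * \<iota> c"
      using lens by (simp add: horner_sum_append hom_distribs)
    then have "\<alpha> * ev (?vs @ [0 - c]) = \<alpha> * (ev us' - \<iota> c * ev pv' - \<alpha> ^ (k - 1) * \<iota> c)"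
      by (simp only:)
    also have "\<dots> = \<alpha> * ev us' - \<iota> c * (\<alpha> * ev pv') - \<iota> c * (\<alpha> * \<alpha> ^ (k - 1))"
      by (simp add: algebra_simps)
    also have "\<dots> = \<alpha> * ev us' - \<iota> c * (\<alpha> * ev pv') - \<iota> c * \<alpha> ^ k"
      by (simp only: mult_power_minus_1)
    also have "\<dots> = \<alpha> * ev us' - \<iota> c * (\<alpha> * ev pv' + \<alpha> ^ k)"
      by (simp add: algebra_simps)
    also have "\<alpha> * ev pv' + \<alpha> ^ k = - \<iota> p0"
      using root p by simp
    also have "\<alpha> * ev us' - \<iota> c * - \<iota> p0 = \<alpha> * ev us' + \<iota> c * \<iota> p0"
      by simp
    also have "\<iota> c * \<iota> p0 = \<iota> u"
      using assms p by (simp add: c_def flip: hom_mult)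
    also have "\<alpha> * ev us' + \<iota> u = \<alpha> * x"
      using us u by (simp add: add.commute)
    finally show ?thesis
      using assms by simp
  qed
  moreover have "length (?vs @ [0 - c]) = k"
    using lens k_pos by simp
  ultimately show ?thesis
    by (intro wp_representsI)
qed

text \<open>The first alternative of the last assumption is for degree 1, where \<alpha> may be 0
  but only \<open>j = 0\<close> occurs.\<close>

lemma wp_div_alpha_pow:
  assumes "has_val M z 0" "has_vals M ps pv" "represents M xs (\<alpha> ^ j * x)"
    "j = 0 \<or> \<alpha> \<noteq> 0 \<and> hd pv \<noteq> 0"
  shows "wp M (div_alpha_pow z ps j xs) (\<lambda>ys M'. represents M' ys x)"
  using assms
proof (induction j arbitrary: M xs)
  case (Suc j)
  have "wp M (div_alpha z ps xs) (\<lambda>ys M'. represents M' ys (\<alpha> ^ j * x))"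
    using Suc.prems by (intro wp_div_alpha) (auto simp: mult.assoc)
  then show ?case
    unfolding div_alpha_pow.simps
    by (rule wp_bind) (use Suc in \<open>auto intro!: Suc.IH intro: has_prefix\<close>)
qed simp

lemma wp_ext_mult:
  assumes "has_val M z 0" "has_vals M ps pv" "represents M xs x" "represents M ys y"
  shows "wp M (ext_mult z ps xs ys) (\<lambda>zs M'. represents M' zs (x * y))"
proof -
  obtain us where us: "has_vals M xs us" "length us = k" "ev us = x"
    using assms by (auto simp: represents_def)
  have "wp M (ext_mult z ps xs ys)
      (\<lambda>zs M'. represents M' zs (fold (\<lambda>u t. \<alpha> * t + \<iota> u * y) (rev us) 0))"
    unfolding ext_mult_def
  proof (rule wp_fold_prog[where S = represents])
    show "has_vals M (rev xs) (rev us)"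
      using us by simp
    have "has_vals M (replicate (length ps) z) (replicate k 0)"
      using assms length_pv by (auto simp: list_all2_conv_all_nth)
    then show "represents M (replicate (length ps) z) 0"
      by (rule representsI) auto
    fix a u s t M' assume *: "has_val M a u" "prefix M M'" "represents M' s t"
    have "wp M' (times_alpha z ps s) (\<lambda>acc M''. represents M'' acc (\<alpha> * t))"
      using * assms by (intro wp_times_alpha) (auto intro: has_prefix)
    then show "wp M' (bind_prog (times_alpha z ps s) (\<lambda>acc. add_multiple a acc ys))
        (\<lambda>acc M''. represents M'' acc (\<alpha> * t + \<iota> u * y))"
    proof (rule wp_bind)
      fix acc M'' assume M'': "prefix M' M''" "represents M'' acc (\<alpha> * t)"
      from M''(2) obtain ts where ts: "has_vals M'' acc ts" "length ts = k" "ev ts = \<alpha> * t"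
        by (auto simp: represents_def)
      have "represents M'' ys y"
        using * M'' assms by (auto intro: represents_prefix)
      then obtain vs where vs: "has_vals M'' ys vs" "length vs = k" "ev vs = y"
        by (auto simp: represents_def)
      have "wp M'' (add_multiple a acc ys) (\<lambda>zs M'. has_vals M' zs (map2 (\<lambda>t v. t + u * v) ts vs))"
        by (rule wp_add_multiple) (use * M'' ts vs in \<open>auto intro: has_prefix\<close>)
      then show "wp M'' (add_multiple a acc ys) (\<lambda>acc M''. represents M'' acc (\<alpha> * t + \<iota> u * y))"
        by (rule wp_representsI) (use ts vs ev_add_multiple[of ts vs u] in simp_all)
    qed
  qed
  moreover have "fold (\<lambda>u t. \<alpha> * t + \<iota> u * y) (rev us) 0 = ev us * y"
    by (induction us) (auto simp: algebra_simps)
  ultimately show ?thesis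
    using us by simp
qed

lemma wp_alpha_multiples:
  assumes "has_val M z 0" "has_vals M ps pv" "represents M xs x"
  shows "wp M (alpha_multiples z ps n xs) (\<lambda>yss M'. list_all2 (represents M') yss (map (\<lambda>j. \<alpha> ^ j * x) [0..<n]))"
  using assms
proof (induction n arbitrary: M xs x)
  case (Suc n)
  have "wp M (times_alpha z ps xs) (\<lambda>ys M'. represents M' ys (\<alpha> * x))"
    using Suc.prems by (rule wp_times_alpha)
  then show ?case
    unfolding alpha_multiples.simps
  proof (rule wp_bind)
    fix ys M1 assume M1: "prefix M M1" "represents M1 ys (\<alpha> * x)"
    then have "wp M1 (alpha_multiples z ps n ys)
        (\<lambda>yss M'. list_all2 (represents M') yss (map (\<lambda>j. \<alpha> ^ j * (\<alpha> * x)) [0..<n]))"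
      using Suc.prems by (intro Suc.IH) (auto intro: has_prefix)
    then show "wp M1 (bind_prog (alpha_multiples z ps n ys) (\<lambda>yss. Return (xs # yss)))
       (\<lambda>yss M'. list_all2 (represents M') yss (map (\<lambda>j. \<alpha> ^ j * x) [0..<Suc n]))"
    proof (rule wp_bind)
      fix yss M2
      assume M2: "prefix M1 M2" "list_all2 (represents M2) yss (map (\<lambda>j. \<alpha> ^ j * (\<alpha> * x)) [0..<n])"
      have "map (\<lambda>j. \<alpha> ^ j * x) [0..<Suc n] = x # map (\<lambda>j. \<alpha> ^ j * (\<alpha> * x)) [0..<n]"
        by (simp add: map_upt_Suc ac_simps del: upt_Suc)
      with M1 M2 Suc.prems show "wp M2 (Return (xs # yss))
          (\<lambda>yss M'. list_all2 (represents M') yss (map (\<lambda>j. \<alpha> ^ j * x) [0..<Suc n]))"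
        by (auto intro: represents_prefix)
    qed
  qed
qed simp

lemma wp_ext_inverse:
  assumes "has_val M z 0" "has_val M e 1" "has_vals M ps pv" "represents M xs x" "x \<noteq> 0"
  shows "wp M (ext_inverse z e ps xs) (\<lambda>ys M'. represents M' ys (inverse x))"
proof -
  have ps: "length ps = k"
    using assms(3) length_pv by (simp add: list_all2_lengthD)
  show ?thesis
    unfolding ext_inverse_def ps
  proof (rule wp_bind[OF wp_alpha_multiples[OF assms(1,3,4)]])
    fix yss M1 assume M1: "prefix M M1" "list_all2 (represents M1) yss (map (\<lambda>j. \<alpha> ^ j * x) [0..<k])"
    then have "\<forall>j<k. \<exists>vs. has_vals M1 (yss ! j) vs \<and> length vs = k \<and> ev vs = \<alpha> ^ j * x"
      by (auto simp: list_all2_conv_all_nth represents_def)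
    then obtain v where v: "\<And>j. j < k \<Longrightarrow> has_vals M1 (yss ! j) (v j)"
        "\<And>j. j < k \<Longrightarrow> length (v j) = k" "\<And>j. j < k \<Longrightarrow> ev (v j) = \<alpha> ^ j * x"
      by metis
    define V where "V = map v [0..<k]"
    define C where "C = map (\<lambda>i. map (\<lambda>r. r ! i) V) [0..<k]"
    have C: "length C = k" "\<forall>c\<in>set C. length c = k" "\<And>i j. i < k \<Longrightarrow> j < k \<Longrightarrow> C ! i ! j = V ! j ! i"
      by (auto simp: C_def V_def)
    \<comment> \<open>\<open>C\<close> is the multiplication by \<open>x\<close> in coordinates.
      Hence its kernel is trivial, by \<open>x \<noteq> 0\<close> and independence, and a solution
      of \<open>C y = e_0\<close> evaluates to the inverse of \<open>x\<close>, as
      \<open>e_0\<close> holds the coordinates of 1.\<close>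
    have combine: "ev (map (\<lambda>i. \<Sum>j<k. C ! i ! j * y j) [0..<k]) = x * ev (map y [0..<k])" for y
    proof -
      have "map (\<lambda>i. \<Sum>j<k. C ! i ! j * y j) [0..<k] = map (\<lambda>i. \<Sum>j<k. V ! j ! i * y j) [0..<k]"
        by (simp add: C)
      then have "ev (map (\<lambda>i. \<Sum>j<k. C ! i ! j * y j) [0..<k]) =
          ev (map (\<lambda>i. \<Sum>j<k. V ! j ! i * y j) [0..<k])"
        by (rule arg_cong)
      also have "\<dots> = (\<Sum>j<k. ev (V ! j) * \<iota> (y j))"
        by (rule ev_linear_combination) (simp add: V_def v)
      also have "\<dots> = x * ev (map y [0..<k])"
        using v by (auto simp: V_def ev_map_upt sum_distrib_left intro!: sum.cong)
      finally show ?thesis .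
    qed
    have "length yss = k"
      using M1 by (simp add: list_all2_lengthD)
    then have "has_rows M1 (columns k yss) C"
      using v by (auto simp: C_def columns_def V_def list_all2_conv_all_nth)
    then have "wp M1 (mat_inv z e k (columns k yss)) (\<lambda>N M'. \<exists>W. has_rows M' N W \<and> length W = k \<and>
       (\<forall>w\<in>set W. length w = k) \<and>
       (\<forall>i<k. \<forall>j<k. (\<Sum>l<k. W ! i ! l * C ! l ! j) = of_bool (i = j)))"
    proof (intro wp_mat_inv)
      fix y assume "\<forall>i<k. (\<Sum>j<k. C ! i ! j * y j) = 0"
      then have "map (\<lambda>i. \<Sum>j<k. C ! i ! j * y j) [0..<k] = replicate k 0"
        by (intro nth_equalityI) auto
      then have "x * ev (map y [0..<k]) = 0"
        using combine[of y] by simp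
      then have "map y [0..<k] = replicate k 0"
        using assms by (intro independent) auto
      then show "\<forall>j<k. y j = 0"
        by (auto simp: list_eq_iff_nth_eq)
    qed (use M1 C assms in \<open>auto intro: has_prefix\<close>)
    then show "wp M1 (bind_prog (mat_inv z e k (columns k yss)) (\<lambda>N. Return (map hd N)))
        (\<lambda>ys M'. represents M' ys (inverse x))"
    proof (rule wp_bind)
      fix N M2 assume "\<exists>W. has_rows M2 N W \<and> length W = k \<and> (\<forall>w\<in>set W. length w = k) \<and>
        (\<forall>i<k. \<forall>j<k. (\<Sum>l<k. W ! i ! l * C ! l ! j) = of_bool (i = j))"
      then obtain W where W: "has_rows M2 N W" "length W = k" "\<forall>w\<in>set W. length w = k"
        "\<forall>i<k. \<forall>j<k. (\<Sum>l<k. W ! i ! l * C ! l ! j) = of_bool (i = j)"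
        by blast
      define y where "y j = W ! j ! 0" for j
      have "\<forall>i<k. (\<Sum>j<k. C ! i ! j * y j) = of_bool (i = 0)"
        using left_inverse_imp_right_inverse[OF W(4)] k_pos by (simp add: y_def)
      then have "map (\<lambda>i. \<Sum>j<k. C ! i ! j * y j) [0..<k] = 1 # replicate (k - 1) 0"
        by (intro nth_equalityI) (use k_pos in \<open>auto simp: nth_Cons'\<close>)
      then have "x * ev (map y [0..<k]) = 1"
        using combine[of y] by simp
      then have inv: "ev (map y [0..<k]) = inverse x"
        by (simp add: inverse_unique)
      have "has_val M2 (hd (N ! i)) (y i)" if "i < k" for i
      proof -
        have "has_vals M2 (N ! i) (W ! i)" "length (W ! i) = k"
          using W that by (simp_all add: list_all2_nthD2)
        moreover from this have "N ! i \<noteq> []"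
          using k_pos by auto
        ultimately show ?thesis
          using has_vals_nth[of M2 "N ! i" "W ! i" 0] k_pos by (simp add: hd_conv_nth y_def)
      qed
      moreover have "length N = k"
        using W by (simp add: list_all2_lengthD)
      ultimately have "has_vals M2 (map hd N) (map y [0..<k])"
        by (simp add: list_all2_conv_all_nth)
      then show "wp M2 (Return (map hd N)) (\<lambda>ys M'. represents M' ys (inverse x))"
        using inv by (auto intro: representsI)
    qed
  qed
qed

end

section \<open>The extension field generated by a root of an irreducible polynomial\<close>

lemma (in field_hom) horner_sum_eq_poly:
  "horner_sum hom x cs = poly (map_poly hom (Poly cs)) x"
  by (induction cs) (auto simp: map_poly_pCons_hom)

text \<open>A nonzero polynomial of minimal degree among those vanishing at \<open>x\<close> divides \<open>p\<close>.\<close>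
lemma (in field_hom) degree_le_if_root_of_irreducible:
  fixes p q :: "'a poly"
  assumes "irreducible p" "poly (map_poly hom p) x = 0" "poly (map_poly hom q) x = 0" "q \<noteq> 0"
  shows "degree p \<le> degree q"
proof -
  interpret map_poly: map_poly_comm_ring_hom hom ..
  obtain d where d: "poly (map_poly hom d) x = 0" "d \<noteq> 0"
    and min: "\<And>r. poly (map_poly hom r) x = 0 \<Longrightarrow> r \<noteq> 0 \<Longrightarrow> degree d \<le> degree r"
    using ex_has_least_nat[of "\<lambda>r. poly (map_poly hom r) x = 0 \<and> r \<noteq> 0" q degree] assms by blast
  have "map_poly hom p = map_poly hom (d * (p div d) + p mod d)"
    by simp
  then have "poly (map_poly hom (p mod d)) x = 0"
    using assms d by (simp only: map_poly.hom_add map_poly.hom_mult poly_add poly_mult) simp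
  with min[of "p mod d"] degree_mod_less[of d p] d have "p mod d = 0"
    by (meson not_le)
  then obtain c where c: "p = d * c"
    unfolding mod_eq_0_iff_dvd dvd_def by blast
  with assms(1) consider "is_unit d" | "is_unit c"
    by (auto dest: irreducibleD)
  then show ?thesis
  proof cases
    case 1
    then obtain a where "d = [:a:]" "a \<noteq> 0"
      using d by (auto simp: is_unit_iff_degree elim: degree_eq_zeroE)
    with d show ?thesis
      by (simp add: map_poly_pCons_hom)
  next
    case 2
    then have "degree p = degree d"
      using c d assms(1) by (cases "c = 0") (auto simp: degree_mult_eq is_unit_iff_degree)
    with min[of q] assms show ?thesis
      by simp
  qed
qed

lemma simple_extension_root:
  fixes p :: "'f::field poly" and \<iota> :: "'f \<Rightarrow> 'e::field"
  assumes "field_hom \<iota>" "lead_coeff p = 1" "irreducible p" "poly (map_poly \<iota> p) \<alpha> = 0"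
  shows "simple_extension \<iota> \<alpha> (map (coeff p) [0..<degree p]) (degree p)"
proof -
  interpret field_hom \<iota>
    by fact
  show ?thesis
  proof unfold_locales
    show "0 < degree p"
      using assms(3) by (auto simp: irreducible_def is_unit_iff_degree)
    have "0 = (\<Sum>i\<le>degree p. \<iota> (coeff p i) * \<alpha> ^ i)"
      using assms(4) by (simp add: poly_altdef)
    also have "\<dots> = (\<Sum>i<degree p. \<iota> (coeff p i) * \<alpha> ^ i) + \<alpha> ^ degree p"
      using assms(2) by (simp flip: lessThan_Suc_atMost)
    finally show "\<alpha> ^ degree p = - horner_sum \<iota> \<alpha> (map (coeff p) [0..<degree p])"
      by (simp add: horner_sum_eq_sum atLeast0LessThan eq_neg_iff_add_eq_0 add.commute)
    fix xs assume xs: "length xs = degree p" "horner_sum \<iota> \<alpha> xs = 0"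
    have "Poly xs = 0"
    proof (rule ccontr)
      assume "Poly xs \<noteq> 0"
      moreover from this have "degree (Poly xs) < length xs"
        by (metis coeff_Poly_eq leading_coeff_0_iff nth_default_beyond not_le)
      ultimately show False
        using degree_le_if_root_of_irreducible[OF assms(3,4), of "Poly xs"] xs
        by (simp add: horner_sum_eq_poly)
    qed
    with xs show "xs = replicate (degree p) 0"
      by (auto simp: Poly_eq_0)
  qed simp
qed

section \<open>Multiplication by the companion matrix and its polynomials\<close>

context simple_extension
begin

lemma psi_eq_ev: "psi \<iota> \<alpha> w = ev (list_of_vec w)"
  by (simp add: psi_def horner_sum_eq_sum atLeast0LessThan list_of_vec_index)

lemma psi_eq_0_iff:
  assumes "w \<in> carrier_vec k"
  shows "psi \<iota> \<alpha> w = 0 \<longleftrightarrow> w = 0\<^sub>v k"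
proof
  assume "psi \<iota> \<alpha> w = 0"
  then have "list_of_vec w = replicate k 0"
    using assms by (intro independent) (auto simp: psi_eq_ev)
  then have "w $ i = 0" if "i < k" for i
    using that assms by (metis list_of_vec_index carrier_vecD nth_replicate)
  with assms show "w = 0\<^sub>v k"
    by (intro eq_vecI) auto
qed (simp add: psi_def)

text \<open>Column \<open>b\<close> of the companion matrix holds the coordinates of
  \<open>\<alpha> ^ Suc b\<close>: a unit vector for \<open>b < k - 1\<close>, and the negated
  coefficients for \<open>b = k - 1\<close>, where \<open>root\<close> applies.\<close>

lemma psi_companion:
  assumes "degree p = k" "pv = map (coeff p) [0..<k]" "w \<in> carrier_vec k"
  shows "psi \<iota> \<alpha> (companion p *\<^sub>v w) = \<alpha> * psi \<iota> \<alpha> w"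
proof -
  obtain n where n: "k = Suc n"
    using k_pos by (cases k) auto
  have less: "Suc b < k" if "b < n" for b
    using that n by simp
  have entry: "(companion p *\<^sub>v w) $ a = (\<Sum>b<n. if a = Suc b then w $ b else 0) - coeff p a * w $ n"
    if "a < k" for a
  proof -
    have "(companion p *\<^sub>v w) $ a = (\<Sum>b<k. companion p $$ (a, b) * w $ b)"
      using that assms by (simp add: companion_def scalar_prod_def atLeast0LessThan)
    also have "\<dots> = (\<Sum>b<n. (if a = Suc b then 1 else 0) * w $ b) - coeff p a * w $ n"
      using that assms n by (simp add: companion_def)
    finally show ?thesis
      by (simp add: if_distrib[of "\<lambda>x. x * _"] cong: if_cong)
  qed
  have summand: "\<iota> ((companion p *\<^sub>v w) $ a) * \<alpha> ^ a =
      (\<Sum>b<n. if a = Suc b then \<iota> (w $ b) * \<alpha> ^ a else 0) - \<iota> (w $ n) * (\<iota> (coeff p a) * \<alpha> ^ a)"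
    if "a < k" for a
  proof -
    have "\<iota> ((companion p *\<^sub>v w) $ a) =
        (\<Sum>b<n. \<iota> (if a = Suc b then w $ b else 0)) - \<iota> (coeff p a) * \<iota> (w $ n)"
      by (simp add: entry[OF that] hom_distribs)
    then have "\<iota> ((companion p *\<^sub>v w) $ a) * \<alpha> ^ a =
        (\<Sum>b<n. \<iota> (if a = Suc b then w $ b else 0)) * \<alpha> ^ a - \<iota> (w $ n) * (\<iota> (coeff p a) * \<alpha> ^ a)"
      by (simp only: left_diff_distrib) (simp add: ac_simps)
    also have "(\<Sum>b<n. \<iota> (if a = Suc b then w $ b else 0)) * \<alpha> ^ a =
        (\<Sum>b<n. if a = Suc b then \<iota> (w $ b) * \<alpha> ^ a else 0)"
      unfolding sum_distrib_right by (rule sum.cong) auto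
    finally show ?thesis .
  qed
  have "psi \<iota> \<alpha> (companion p *\<^sub>v w) = (\<Sum>a<k. \<iota> ((companion p *\<^sub>v w) $ a) * \<alpha> ^ a)"
    using assms by (simp add: psi_def companion_def)
  also have "\<dots> = (\<Sum>a<k. \<Sum>b<n. if a = Suc b then \<iota> (w $ b) * \<alpha> ^ a else 0) -
      \<iota> (w $ n) * (\<Sum>a<k. \<iota> (coeff p a) * \<alpha> ^ a)"
    by (simp add: summand sum_subtractf sum_distrib_left)
  also have "(\<Sum>a<k. \<iota> (coeff p a) * \<alpha> ^ a) = - (\<alpha> ^ k)"
    using root assms by (simp add: ev_map_upt)
  \<comment> \<open>After exchanging the sums, the inner one has the single nonzero term
    \<open>a = Suc b\<close>, which \<open>less\<close> places in the range of summation.\<close>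
  also have "(\<Sum>a<k. \<Sum>b<n. if a = Suc b then \<iota> (w $ b) * \<alpha> ^ a else 0) = (\<Sum>b<n. \<iota> (w $ b) * \<alpha> ^ Suc b)"
    by (subst sum.swap) (auto simp: less intro!: sum.cong)
  finally show ?thesis
    using assms n by (simp add: psi_def sum_distrib_left algebra_simps)
qed

lemma psi_companion_pow:
  assumes "degree p = k" "pv = map (coeff p) [0..<k]" "w \<in> carrier_vec k"
  shows "psi \<iota> \<alpha> (companion p ^\<^sub>m i *\<^sub>v w) = \<alpha> ^ i * psi \<iota> \<alpha> w"
  using assms(3)
proof (induction i arbitrary: w)
  case 0
  then show ?case
    using assms by (simp add: companion_def)
next
  case (Suc i)
  have P: "companion p \<in> carrier_mat k k"
    using assms by (simp add: companion_def)
  then have "companion p ^\<^sub>m Suc i *\<^sub>v w = companion p ^\<^sub>m i *\<^sub>v (companion p *\<^sub>v w)"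
    using assoc_mult_mat_vec[OF pow_carrier_mat[OF P] P Suc.prems] by simp
  with Suc P assms show ?case
    by (simp add: psi_companion)
qed

text \<open>For \<open>B = f(P)\<close> the factor is \<open>f(\<alpha>)\<close>, by linearity from
  the powers of \<open>P\<close>.\<close>

lemma psi_matrix_algebra:
  assumes "degree p = k" "pv = map (coeff p) [0..<k]" "B \<in> matrix_algebra k (companion p)"
  shows "\<exists>\<beta>. \<forall>w\<in>carrier_vec k. psi \<iota> \<alpha> (B *\<^sub>v w) = \<beta> * psi \<iota> \<alpha> w"
proof -
  let ?P = "companion p"
  obtain f where B: "B = mat k k (\<lambda>ab. \<Sum>i\<le>degree f. coeff f i * (?P ^\<^sub>m i) $$ ab)"
    using assms(3) by (auto simp: matrix_algebra_def)
  have dim: "dim_row ?P = k" "dim_col ?P = k"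
    using assms by (simp_all add: companion_def Let_def)
  have P: "?P ^\<^sub>m i \<in> carrier_mat k k" for i
    using assms by (intro pow_carrier_mat) (simp add: companion_def)
  have "psi \<iota> \<alpha> (B *\<^sub>v w) = (\<Sum>i\<le>degree f. \<iota> (coeff f i) * \<alpha> ^ i) * psi \<iota> \<alpha> w"
    if w: "w \<in> carrier_vec k" for w
  proof -
    have entry: "(B *\<^sub>v w) $ a = (\<Sum>i\<le>degree f. coeff f i * (?P ^\<^sub>m i *\<^sub>v w) $ a)" if "a < k" for a
    proof -
      have "(B *\<^sub>v w) $ a = (\<Sum>b<k. \<Sum>i\<le>degree f. coeff f i * (?P ^\<^sub>m i) $$ (a, b) * w $ b)"
        using that w by (simp add: B scalar_prod_def atLeast0LessThan sum_distrib_right)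
      also have "\<dots> = (\<Sum>i\<le>degree f. \<Sum>b<k. coeff f i * (?P ^\<^sub>m i) $$ (a, b) * w $ b)"
        by (rule sum.swap)
      also have "\<dots> = (\<Sum>i\<le>degree f. coeff f i * (?P ^\<^sub>m i *\<^sub>v w) $ a)"
      proof (rule sum.cong)
        fix i
        have "(?P ^\<^sub>m i *\<^sub>v w) $ a = (\<Sum>b<k. (?P ^\<^sub>m i) $$ (a, b) * w $ b)"
          using that w dim by (simp add: scalar_prod_def atLeast0LessThan)
        then show "(\<Sum>b<k. coeff f i * (?P ^\<^sub>m i) $$ (a, b) * w $ b) = coeff f i * (?P ^\<^sub>m i *\<^sub>v w) $ a"
          by (simp add: sum_distrib_left mult.assoc)
      qed simp
      finally show ?thesis .
    qed
    have dim_B: "dim_vec (B *\<^sub>v w) = k"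
      by (simp add: B)
    have dim_vec: "dim_vec (?P ^\<^sub>m i *\<^sub>v w) = k" for i
      using dim by simp
    have "psi \<iota> \<alpha> (B *\<^sub>v w) = (\<Sum>a<k. \<Sum>i\<le>degree f. \<iota> (coeff f i) * (\<iota> ((?P ^\<^sub>m i *\<^sub>v w) $ a) * \<alpha> ^ a))"
      unfolding psi_def dim_B by (rule sum.cong) (auto simp: entry hom_distribs sum_distrib_right mult.assoc)
    also have "\<dots> = (\<Sum>i\<le>degree f. \<iota> (coeff f i) * psi \<iota> \<alpha> (?P ^\<^sub>m i *\<^sub>v w))"
      by (subst sum.swap) (simp only: psi_def dim_vec sum_distrib_left)
    finally show ?thesis
      using w assms by (simp add: psi_companion_pow sum_distrib_right mult.assoc)
  qed
  then show ?thesis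
    by blast
qed

end

section \<open>Received blocks\<close>

text \<open>The kernel is the orthogonal complement of the row space, so matrices with equal row
  spaces have equal kernels. This compares \<open>U\<close> with the normalized block row without
  constructing a change of basis.\<close>

lemma mult_mat_vec_eq_0_iff_row_space:
  fixes N :: "'f::field mat"
  assumes N: "N \<in> carrier_mat nr n" and x: "x \<in> carrier_vec n"
  shows "N *\<^sub>v x = 0\<^sub>v nr \<longleftrightarrow> (\<forall>r\<in>vec_space.row_space n N. r \<bullet> x = 0)"
proof -
  have transpose: "(N\<^sup>T *\<^sub>v y) \<bullet> x = y \<bullet> (N *\<^sub>v x)" if "y \<in> carrier_vec nr" for y
    using transpose_vec_mult_scalar[OF N x that] .
  have row_space: "vec_space.row_space n N =
      {w \<in> carrier_vec n. \<exists>y\<in>carrier_vec nr. N\<^sup>T *\<^sub>v y = w}"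
    using vec_space.row_space_eq[OF N] N by auto
  show ?thesis
  proof
    assume "N *\<^sub>v x = 0\<^sub>v nr"
    with transpose show "\<forall>r\<in>vec_space.row_space n N. r \<bullet> x = 0"
      by (auto simp: row_space)
  next
    assume *: "\<forall>r\<in>vec_space.row_space n N. r \<bullet> x = 0"
    show "N *\<^sub>v x = 0\<^sub>v nr"
    proof (rule eq_vecI)
      fix i assume "i < dim_vec (0\<^sub>v nr)"
      then have i: "i < nr" by simp
      have "N\<^sup>T *\<^sub>v unit_vec nr i \<in> vec_space.row_space n N"
        using N by (auto simp: row_space)
      with * transpose[of "unit_vec nr i"] have "unit_vec nr i \<bullet> (N *\<^sub>v x) = 0"
        by auto
      with i N x show "(N *\<^sub>v x) $ i = 0\<^sub>v nr $ i"
        using scalar_prod_left_unit[of "N *\<^sub>v x" nr i] by auto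
    qed (use N in auto)
  qed
qed

definition block_vec :: "nat \<Rightarrow> nat \<Rightarrow> nat \<Rightarrow> 'f::zero vec \<Rightarrow> 'f vec" where
  "block_vec m k s x = vec (m * k) (\<lambda>c. if c div k = s then x $ (c mod k) else 0)"

lemma block_vec_carrier [simp]: "block_vec m k s x \<in> carrier_vec (m * k)"
  by (simp add: block_vec_def)

lemma block_index_less:
  fixes s m k j :: nat
  assumes "s < m" "j < k"
  shows "s * k + j < m * k"
proof -
  have "s * k + j < Suc s * k"
    using assms by simp
  also have "\<dots> \<le> m * k"
    using assms by (intro mult_right_mono) auto
  finally show ?thesis .
qed

lemma mult_block_vec:
  fixes N :: "'f::field mat"
  assumes N: "N \<in> carrier_mat k (m * k)" and "s < m" and x: "x \<in> carrier_vec k"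
  shows "N *\<^sub>v block_vec m k s x = mat k k (\<lambda>(a, j). N $$ (a, s * k + j)) *\<^sub>v x"
proof (rule eq_vecI)
  fix a assume "a < dim_vec (mat k k (\<lambda>(a, j). N $$ (a, s * k + j)) *\<^sub>v x)"
  then have a: "a < k" by simp
  have "(N *\<^sub>v block_vec m k s x) $ a =
      (\<Sum>c<m * k. N $$ (a, c) * (if c div k = s then x $ (c mod k) else 0))"
    using a N by (auto simp: scalar_prod_def block_vec_def atLeast0LessThan)
  also have "\<dots> = (\<Sum>c\<in>{c. c < m * k \<and> c div k = s}. N $$ (a, c) * x $ (c mod k))"
    by (rule sum.mono_neutral_cong_right) auto
  also have "\<dots> = (\<Sum>j<k. N $$ (a, s * k + j) * x $ j)"
    by (rule sum.reindex_bij_witness[of _ "\<lambda>j. s * k + j" "\<lambda>c. c mod k"])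
      (use a assms block_index_less in auto)
  finally show "(N *\<^sub>v block_vec m k s x) $ a = (mat k k (\<lambda>(a, j). N $$ (a, s * k + j)) *\<^sub>v x) $ a"
    using a x by (simp add: scalar_prod_def atLeast0LessThan)
qed (use N in auto)

lemma (in simple_extension) received_block_injective:
  assumes p: "degree p = k" "pv = map (coeff p) [0..<k]"
    and R: "received m k (companion p) R" and s: "s < m" "nonzero_unerased_block k R s"
    and x: "x \<in> carrier_vec k" "received_block k R s *\<^sub>v x = 0\<^sub>v k"
  shows "x = 0\<^sub>v k"
proof (rule ccontr)
  assume "x \<noteq> 0\<^sub>v k"
  from R obtain U A E where U: "U \<in> carrier_mat k (m * k)"
      and code: "vec_space.row_space (m * k) U \<in> spread_code m k (companion p)"
      and A: "A \<in> carrier_mat k k" "invertible_mat A" and R_eq: "R = erase_columns E (A * U)"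
    by (auto simp: received_def)
  from code obtain B i where span: "vec_space.row_space (m * k) U = vec_space.row_space (m * k) (block_row k m B)"
    and B: "i < m" "\<forall>j<i. B j = 0\<^sub>m k k" "B i = 1\<^sub>m k"
      "\<forall>j. i < j \<and> j < m \<longrightarrow> B j \<in> matrix_algebra k (companion p)"
    by (auto simp: spread_code_def)
  have B_dim: "B j \<in> carrier_mat k k" if "j < m" for j
    using B that by (cases j i rule: linorder_cases) (auto simp: matrix_algebra_def)
  \<comment> \<open>The three kinds of blocks of a codeword: zero before the identity block (factor
    0), the identity itself (factor 1), and elements of the matrix algebra after it.\<close>
  have "\<exists>\<beta>. \<forall>w\<in>carrier_vec k. psi \<iota> \<alpha> (B s *\<^sub>v w) = \<beta> * psi \<iota> \<alpha> w"
  proof (cases s i rule: linorder_cases)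
    case less
    then show ?thesis
      using B by (intro exI[of _ 0]) (auto simp: psi_def)
  next
    case equal
    then show ?thesis
      using B by (intro exI[of _ 1]) auto
  next
    case greater
    then show ?thesis
      using B s p by (intro psi_matrix_algebra) auto
  qed
  then obtain \<beta> where \<beta>: "\<And>w. w \<in> carrier_vec k \<Longrightarrow> psi \<iota> \<alpha> (B s *\<^sub>v w) = \<beta> * psi \<iota> \<alpha> w"
    by blast
  obtain A' where A': "A' \<in> carrier_mat k k" "A' * A = 1\<^sub>m k"
    using A unfolding invertible_mat_def inverts_mat_def
    by (metis carrier_matD carrier_matI index_mult_mat(2,3) index_one_mat(2,3))
  have mult_0: "N *\<^sub>v 0\<^sub>v k = 0\<^sub>v k" if "N \<in> carrier_mat k k" for N :: "'f mat"
    using that by (intro eq_vecI) (auto simp: scalar_prod_def)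
  have kernel_iff: "received_block k R s *\<^sub>v w = 0\<^sub>v k \<longleftrightarrow> B s *\<^sub>v w = 0\<^sub>v k" if w: "w \<in> carrier_vec k" for w
  proof -
    let ?w = "block_vec m k s w"
    have "received_block k R s = mat k k (\<lambda>(a, j). (A * U) $$ (a, s * k + j))"
      using A U s block_index_less[OF s(1)]
      by (intro eq_matI)
        (auto simp: received_block_def R_eq erase_columns_def nonzero_unerased_block_def unerased_column_def)
    then have "received_block k R s *\<^sub>v w = A * U *\<^sub>v ?w"
      using A U s w by (simp add: mult_block_vec)
    also have "\<dots> = 0\<^sub>v k \<longleftrightarrow> U *\<^sub>v ?w = 0\<^sub>v k"
    proof
      assume "A * U *\<^sub>v ?w = 0\<^sub>v k"
      then have "A *\<^sub>v (U *\<^sub>v ?w) = 0\<^sub>v k"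
        using A U by (simp add: assoc_mult_mat_vec[of A k k U "m * k"])
      then have "A' * A *\<^sub>v (U *\<^sub>v ?w) = A' *\<^sub>v 0\<^sub>v k"
        using assoc_mult_mat_vec[OF A'(1) A(1), of "U *\<^sub>v ?w"] U by simp
      then show "U *\<^sub>v ?w = 0\<^sub>v k"
        using A' U mult_0 by auto
    qed (use A U mult_0 in \<open>simp add: assoc_mult_mat_vec[of A k k U "m * k"]\<close>)
    also have "\<dots> \<longleftrightarrow> block_row k m B *\<^sub>v ?w = 0\<^sub>v k"
      using U span by (simp add: mult_mat_vec_eq_0_iff_row_space[of _ k "m * k"] block_row_def)
    also have "block_row k m B *\<^sub>v ?w = B s *\<^sub>v w"
    proof -
      have "mat k k (\<lambda>(a, j). block_row k m B $$ (a, s * k + j)) = B s"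
        using B_dim[OF s(1)] block_index_less[OF s(1)] by (intro eq_matI) (auto simp: block_row_def)
      then show ?thesis
        using s w by (simp add: mult_block_vec[of _ k m] block_row_def)
    qed
    finally show ?thesis .
  qed
  have "psi \<iota> \<alpha> (B s *\<^sub>v x) = 0"
    using kernel_iff x by (simp add: psi_def)
  then have "\<beta> = 0"
    using \<beta> x \<open>x \<noteq> 0\<^sub>v k\<close> by (simp add: psi_eq_0_iff)
  \<comment> \<open>A single nonzero kernel vector has forced the factor to be 0, so the kernel is
    the whole space. Applied to unit vectors this makes all entries of the block 0, while the block
    is known to have a nonzero one.\<close>
  then have zero: "received_block k R s *\<^sub>v w = 0\<^sub>v k" if "w \<in> carrier_vec k" for w
    using \<beta>[OF that] kernel_iff[OF that] psi_eq_0_iff[of "B s *\<^sub>v w"] B_dim[OF s(1)] that by auto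
  obtain a j where aj: "a < k" "j < k" "R $$ (a, s * k + j) \<noteq> Some 0" "R $$ (a, s * k + j) \<noteq> None"
    using s(2) by (auto simp: nonzero_unerased_block_def nonzero_column_def unerased_column_def)
  have "received_block k R s $$ (a, j) = (received_block k R s *\<^sub>v unit_vec k j) $ a"
    using aj by (simp add: received_block_def)
  also have "\<dots> = 0"
    using aj zero[of "unit_vec k j"] by simp
  finally show False
    using aj by (auto simp: received_block_def)
qed

section \<open>Correctness of the decoder\<close>

lemma nth_concat_map_upt:
  assumes "a < r" "c < n"
  shows "concat (map (\<lambda>a. map (f a) [0..<n]) [0..<r]) ! (a * n + c) = f a c"
  using assms
proof (induction r)
  case (Suc r)
  have len: "length (concat (map (\<lambda>a. map (f a) [0..<n]) [0..<r])) = r * n"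
    by (simp add: length_concat comp_def sum_list_triv)
  show ?case
  proof (cases "a = r")
    case True
    with Suc.prems len show ?thesis
      by (simp add: nth_append)
  next
    case False
    with Suc.prems have "a < r"
      by simp
    with Suc len block_index_less[OF \<open>a < r\<close> \<open>c < n\<close>] show ?thesis
      by (simp add: nth_append)
  qed
qed simp

lemma input_memory_coeff:
  assumes "prefix (input_memory p R) M"
  shows "has_vals M [0..<degree p] (map (coeff p) [0..<degree p])"
  using assms
  by (auto simp: prefix_def input_memory_def list_all2_conv_all_nth has_val_def nth_append)

lemma input_memory_cell:
  assumes "prefix (input_memory p R) M" "R \<in> carrier_mat k (m * k)" "degree p = k" "a < k" "c < m * k"
  shows "k + a * (m * k) + c < length M" "M ! (k + a * (m * k) + c) = R $$ (a, c)"
proof -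
  let ?rows = "concat (map (\<lambda>a. map (\<lambda>c. R $$ (a, c)) [0..<m * k]) [0..<k])"
  have input: "input_memory p R = map (\<lambda>i. Some (coeff p i)) [0..<k] @ ?rows"
    using assms by (simp add: input_memory_def)
  have len: "length ?rows = k * (m * k)"
    by (simp add: length_concat comp_def sum_list_triv)
  have "a * (m * k) + c < k * (m * k)"
    using assms by (intro block_index_less) auto
  with len have less: "k + a * (m * k) + c < length (input_memory p R)"
    by (simp add: input)
  with assms(1) show "k + a * (m * k) + c < length M"
    using prefix_length_le[OF assms(1)] by simp
  have "M ! (k + a * (m * k) + c) = input_memory p R ! (k + a * (m * k) + c)"
    using assms(1) less by (auto simp: prefix_def nth_append)
  also have "\<dots> = R $$ (a, c)"
    using nth_concat_map_upt[of a k c "m * k" "\<lambda>a c. R $$ (a, c)"] assms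
    by (simp add: input nth_append add.assoc)
  finally show "M ! (k + a * (m * k) + c) = R $$ (a, c)" .
qed

lemma received_carrier: "received m k P R \<Longrightarrow> R \<in> carrier_mat k (m * k)"
  by (auto simp: received_def erase_columns_def)

text \<open>Coordinate lists will be obtained only for \<open>i < m\<close>, so the output function
  built from them is determined only there.\<close>

lemma decoding_output_cong:
  assumes "\<And>i. i < m \<Longrightarrow> v i = v' i"
  shows "decoding_output m k \<iota> \<alpha> R v = decoding_output m k \<iota> \<alpha> R v'"
proof -
  have "(\<forall>i<m. v i = f i) \<longleftrightarrow> (\<forall>i<m. v' i = f i)" for f
    using assms by simp
  then show ?thesis
    by (simp only: decoding_output_def)
qed

section \<open>The decoder on a received matrix\<close>

locale decoding = simple_extension \<iota> \<alpha> "map (coeff p) [0..<k]" k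
  for \<iota> :: "'f::field \<Rightarrow> 'e::field" and \<alpha> :: 'e and p :: "'f poly" and k :: nat +
  fixes m :: nat and R :: "'f option mat"
  assumes degree_p: "degree p = k" and received: "received m k (companion p) R"
begin

abbreviation extends_input :: "'f option list \<Rightarrow> bool" where
  "extends_input \<equiv> prefix (input_memory p R)"

definition column_addrs :: "nat \<Rightarrow> nat \<Rightarrow> addr list" where
  "column_addrs i j = map (\<lambda>a. k + a * (m * k) + (i * k + j)) [0..<k]"

lemma zip_columns: "zip [0..<k] (columns k (block_addrs m k i)) = map (\<lambda>j. (j, column_addrs i j)) [0..<k]"
  by (intro nth_equalityI) (auto simp: columns_def block_addrs_def column_addrs_def)

lemma block_cell:
  assumes "extends_input M" "i < m" "a < k" "j < k"
  shows "k + a * (m * k) + (i * k + j) < length M"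
    "M ! (k + a * (m * k) + (i * k + j)) = R $$ (a, i * k + j)"
  using input_memory_cell[OF assms(1) received_carrier[OF received] degree_p assms(3)]
    block_index_less[OF assms(2,4)] by auto

lemma column_cells:
  assumes "extends_input M" "i < m" "j < k"
  shows "(!) M ` set (column_addrs i j) = (\<lambda>a. R $$ (a, i * k + j)) ` {..<k}"
  using block_cell(2)[OF assms(1,2) _ assms(3)] by (auto simp: column_addrs_def image_image)

lemma None_notin_column_iff:
  "None \<notin> (\<lambda>a. R $$ (a, i * k + j)) ` {..<k} \<longleftrightarrow> unerased_column k R i j"
  by (simp add: unerased_column_def image_iff Ball_def eq_commute[of None])

lemma nonzero_column_iff:
  assumes "extends_input M" "i < m" "j < k"
  shows "nonzero_cells M (column_addrs i j) \<longleftrightarrow> nonzero_column k R i j"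
  unfolding nonzero_cells_def column_cells[OF assms] nonzero_column_def None_notin_column_iff
  by auto

lemma block_cells:
  assumes "extends_input M" "i < m"
  shows "(!) M ` set (concat (block_addrs m k i)) = (\<Union>j<k. (\<lambda>a. R $$ (a, i * k + j)) ` {..<k})"
proof -
  have "set (concat (block_addrs m k i)) = (\<Union>j<k. set (column_addrs i j))"
    by (auto simp: block_addrs_def column_addrs_def)
  then show ?thesis
    using column_cells[OF assms] by (simp add: image_UN)
qed

lemma nonzero_unerased_block_iff:
  assumes "extends_input M" "i < m"
  shows "nonzero_cells M (concat (block_addrs m k i)) \<longleftrightarrow> nonzero_unerased_block k R i"
proof -
  have "None \<notin> (\<Union>j<k. (\<lambda>a. R $$ (a, i * k + j)) ` {..<k}) \<longleftrightarrow> (\<forall>j<k. unerased_column k R i j)"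
    by (simp add: None_notin_column_iff Ball_def)
  moreover have "(\<Union>j<k. (\<lambda>a. R $$ (a, i * k + j)) ` {..<k}) \<subseteq> {Some 0} \<longleftrightarrow>
      (\<forall>j<k. \<forall>a<k. R $$ (a, i * k + j) = Some 0)"
    by auto
  ultimately show ?thesis
    unfolding nonzero_cells_def block_cells[OF assms] nonzero_unerased_block_def nonzero_column_def
    by simp blast
qed

lemma has_vals_column:
  assumes "extends_input M" "i < m" "j < k" "unerased_column k R i j"
  shows "has_vals M (column_addrs i j) (list_of_vec (received_column k R i j))"
  using block_cell[OF assms(1,2) _ assms(3)] assms(4)
  by (auto simp: column_addrs_def list_all2_conv_all_nth has_val_def received_column_def
      unerased_column_def list_of_vec_index)

lemma has_rows_block:
  assumes "extends_input M" "i < m" "nonzero_unerased_block k R i"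
  shows "has_rows M (block_addrs m k i)
    (map (\<lambda>a. map (\<lambda>j. received_block k R i $$ (a, j)) [0..<k]) [0..<k])"
  using block_cell[OF assms(1,2)] assms(3)
  by (auto simp: block_addrs_def list_all2_conv_all_nth has_val_def received_block_def
      nonzero_unerased_block_def unerased_column_def)

text \<open>\<open>decoded Rinv i x\<close>: the element \<open>x\<close> is a possible value of \<open>u\<^sub>i\<close> in step 2 of the algorithm.\<close>
definition decoded :: "'f mat \<Rightarrow> nat \<Rightarrow> 'e \<Rightarrow> bool" where
  "decoded Rinv i x \<longleftrightarrow> (if \<exists>c<k. nonzero_column k R i c
     then \<exists>j<k. nonzero_column k R i j \<and>
            x = inverse \<alpha> ^ j * psi \<iota> \<alpha> (Rinv *\<^sub>v received_column k R i j)
     else x = 0)"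

lemma alpha_nonzero: "j < k \<Longrightarrow> j = 0 \<or> \<alpha> \<noteq> 0 \<and> hd (map (coeff p) [0..<k]) \<noteq> 0"
  using nonzero_if_degree_gt_1 by (cases "j = 0") auto

lemma wp_decode_block:
  assumes "extends_input M" "has_val M z 0" "has_rows M A W" "i < m"
    and "length W = k" "\<forall>w\<in>set W. length w = k"
    and Rinv: "Rinv = mat k k (\<lambda>(i, j). W ! i ! j)"
  shows "wp M (decode_block z [0..<k] A (block_addrs m k i))
    (\<lambda>u M'. \<exists>x. represents M' u x \<and> decoded Rinv i x)"
proof -
  let ?cells = "zip [0..<k] (columns k (block_addrs m k i))"
  have ps: "has_vals M [0..<k] (map (coeff p) [0..<k])"
    using input_memory_coeff[OF assms(1)] by (simp add: degree_p)
  have "wp M (find_nonzero snd ?cells) (\<lambda>res M'. M' = M \<and>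
      (case res of None \<Rightarrow> \<forall>j<k. \<not> nonzero_column k R i j
       | Some (j, r) \<Rightarrow> j < k \<and> nonzero_column k R i j \<and> r = column_addrs i j))"
    by (rule wp_mono[OF wp_find_nonzero])
      (auto simp: zip_columns nonzero_column_iff[OF assms(1,4)] split: option.splits)
  then show ?thesis
    unfolding decode_block_def length_upt minus_nat.diff_0
  proof (rule wp_bind, goal_cases)
    case (1 res M')
    show ?case
    proof (cases res)
      case None
      have "has_vals M (replicate k z) (replicate k 0)"
        using assms(2) by (auto simp: list_all2_conv_all_nth)
      then have "represents M (replicate k z) 0"
        by (rule representsI) auto
      with 1 None show ?thesis
        by (auto simp: decoded_def)
    next
      case (Some jr)
      with 1 obtain j where j: "jr = (j, column_addrs i j)" "j < k" "nonzero_column k R i j" and M': "M' = M"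
        by (auto split: prod.splits)
      let ?c = "received_column k R i j"
      define x where "x = inverse \<alpha> ^ j * psi \<iota> \<alpha> (Rinv *\<^sub>v ?c)"
      have "has_vals M (column_addrs i j) (list_of_vec ?c)"
        using assms j by (intro has_vals_column) (auto simp: nonzero_column_def)
      then have "wp M (mat_vec_mult z A (column_addrs i j))
          (\<lambda>ys M'. has_vals M' ys (map (\<lambda>v. \<Sum>i<k. v ! i * list_of_vec ?c ! i) W))"
        using assms by (intro wp_mat_vec_mult) (auto simp: received_column_def)
      moreover have "map (\<lambda>v. \<Sum>i<k. v ! i * list_of_vec ?c ! i) W = list_of_vec (Rinv *\<^sub>v ?c)"
        using assms
        by (intro nth_equalityI)
          (auto simp: list_of_vec_index received_column_def scalar_prod_def atLeast0LessThan)
      \<comment> \<open>If \<alpha> is 0, then \<open>j = 0\<close> and both powers are 1, so the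
        equation holds in this case too.\<close>
      moreover have "psi \<iota> \<alpha> (Rinv *\<^sub>v ?c) = \<alpha> ^ j * x"
        using alpha_nonzero[OF j(2)] by (auto simp: x_def power_inverse)
      ultimately have "wp M (mat_vec_mult z A (column_addrs i j)) (\<lambda>h M'. represents M' h (\<alpha> ^ j * x))"
        by (intro wp_representsI[of _ _ "list_of_vec (Rinv *\<^sub>v ?c)"]) (auto simp: psi_eq_ev Rinv)
      then have "wp M (bind_prog (mat_vec_mult z A (column_addrs i j)) (div_alpha_pow z [0..<k] j))
          (\<lambda>u M'. represents M' u x)"
      proof (rule wp_bind)
        fix h M' assume "prefix M M'" "represents M' h (\<alpha> ^ j * x)"
        then show "wp M' (div_alpha_pow z [0..<k] j h) (\<lambda>u M'. represents M' u x)"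
          using has_val_prefix[OF _ assms(2)] has_vals_prefix[OF _ ps] alpha_nonzero[OF j(2)]
          by (intro wp_div_alpha_pow)
      qed
      then have "wp M (bind_prog (mat_vec_mult z A (column_addrs i j)) (div_alpha_pow z [0..<k] j))
          (\<lambda>u M'. \<exists>x. represents M' u x \<and> decoded Rinv i x)"
        by (rule wp_mono) (use j in \<open>auto simp: decoded_def x_def\<close>)
      with Some j M' show ?thesis
        by simp
    qed
  qed
qed

text \<open>By independence, 0 has only the zero coordinate list, and cells holding coordinates are
  never erased. Thus the search on cells finds the first nonzero element \<open>u\<close>.\<close>

lemma represents_nonzero_iff:
  assumes "represents M u x"
  shows "nonzero_cells M u \<longleftrightarrow> x \<noteq> 0"
proof -
  obtain vs where vs: "has_vals M u vs" "length vs = k" "ev vs = x"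
    using assms by (auto simp: represents_def)
  have "(!) M ` set u = Some ` set vs"
    using map_nth_has_vals[OF vs(1)] by (metis set_map)
  moreover have "set vs \<subseteq> {0} \<longleftrightarrow> x = 0"
  proof
    assume "set vs \<subseteq> {0}"
    then have "vs = replicate k 0"
      using vs(2) by (metis empty_iff insert_iff replicate_eqI subsetD)
    with vs(3) show "x = 0"
      by simp
  next
    assume "x = 0"
    then have "vs = replicate k 0"
      using vs by (intro independent) auto
    then show "set vs \<subseteq> {0}"
      by auto
  qed
  ultimately show ?thesis
    by (auto simp: nonzero_cells_def)
qed

lemma wp_decoder:
  "wp (input_memory p R) (decoder m k)
     (\<lambda>vs M. \<exists>y. list_all2 (represents M) vs (map y [0..<m]) \<and> decoding_output m k \<iota> \<alpha> R y)"
  unfolding decoder_def Let_def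
proof (rule wp_bind[OF wp_Zero], goal_cases)
  case (1 z M1)
  show ?case
  proof (rule wp_bind[OF wp_One], goal_cases)
    case (1 e M2)
    note M2 = \<open>has_val M1 z 0\<close> \<open>prefix (input_memory p R) M1\<close> 1
    have input2: "extends_input M2" and z2: "has_val M2 z 0" and e2: "has_val M2 e 1"
      using M2 by (auto intro: has_prefix prefix_order.trans)
    let ?blocks = "map (block_addrs m k) [0..<m]"
    \<comment> \<open>The existence of such a block is part of the input condition and rules out the
      result \<open>None\<close> of the search.\<close>
    obtain s0 where "s0 < m" "nonzero_unerased_block k R s0"
      using received by (auto simp: received_def)
    then have "wp M2 (find_nonzero concat ?blocks) (\<lambda>star M'. M' = M2 \<and>
        (\<exists>s<m. nonzero_unerased_block k R s \<and> star = Some (block_addrs m k s)))"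
      by (intro wp_mono[OF wp_find_nonzero])
        (auto simp: nonzero_unerased_block_iff[OF input2] split: option.splits)
    then show ?case
    proof (rule wp_bind, goal_cases)
      case (1 star M3)
      then obtain s where s: "s < m" "nonzero_unerased_block k R s" and M3: "M3 = M2"
        and star: "star = Some (block_addrs m k s)"
        by auto
      let ?V = "map (\<lambda>a. map (\<lambda>j. received_block k R s $$ (a, j)) [0..<k]) [0..<k]"
      have inj: "\<forall>j<k. x j = 0" if "\<forall>i<k. (\<Sum>j<k. ?V ! i ! j * x j) = 0" for x
      proof -
        have "received_block k R s *\<^sub>v vec k x = 0\<^sub>v k"
          using that by (intro eq_vecI) (auto simp: scalar_prod_def atLeast0LessThan received_block_def)
        then have "vec k x = 0\<^sub>v k"
          using received_block_injective[OF degree_p refl received s] by simp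
        then show ?thesis
          by (metis index_vec index_zero_vec(1))
      qed
      have "wp M2 (mat_inv z e k (block_addrs m k s)) (\<lambda>N M'. \<exists>W. has_rows M' N W \<and> length W = k \<and>
         (\<forall>w\<in>set W. length w = k) \<and>
         (\<forall>i<k. \<forall>j<k. (\<Sum>l<k. W ! i ! l * ?V ! l ! j) = of_bool (i = j)))"
        by (rule wp_mat_inv[OF z2 e2 has_rows_block[OF input2 s] _ _ inj]) auto
      then show ?case
        unfolding star M3 option.case
      proof (rule wp_bind, goal_cases)
        case (1 A M4)
        then obtain W where W: "has_rows M4 A W" "length W = k" "\<forall>w\<in>set W. length w = k"
          "\<forall>i<k. \<forall>j<k. (\<Sum>l<k. W ! i ! l * ?V ! l ! j) = of_bool (i = j)"
          by blast
        define Rinv where "Rinv = mat k k (\<lambda>(i, j). W ! i ! j)"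
        let ?Rs = "received_block k R s"
        have carriers: "Rinv \<in> carrier_mat k k" "?Rs \<in> carrier_mat k k"
          by (auto simp: Rinv_def received_block_def)
        have left: "Rinv * ?Rs = 1\<^sub>m k"
        proof (rule eq_matI)
          fix i j assume "i < dim_row (1\<^sub>m k)" "j < dim_col (1\<^sub>m k)"
          then have ij: "i < k" "j < k" by auto
          have "(Rinv * ?Rs) $$ (i, j) = (\<Sum>l<k. W ! i ! l * ?V ! l ! j)"
            using ij by (simp add: Rinv_def received_block_def scalar_prod_def atLeast0LessThan)
          with W(4) ij show "(Rinv * ?Rs) $$ (i, j) = 1\<^sub>m k $$ (i, j)"
            by simp
        qed (use carriers in auto)
        have right: "?Rs * Rinv = 1\<^sub>m k"
          using mat_mult_left_right_inverse[OF carriers left] .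
        have inverse: "inverts_mat ?Rs Rinv" "inverts_mat Rinv ?Rs"
          using left right carriers by (auto simp: inverts_mat_def)
        have input4: "extends_input M4" and z4: "has_val M4 z 0" and e4: "has_val M4 e 1"
          using input2 z2 e2 1(1) by (auto intro: has_prefix prefix_order.trans)
        \<comment> \<open>The abstract value attached to a block is just its index, since the
          element decoded from it is known only up to the choice of a column. The elements
          \<open>x i\<close> are fixed afterwards.\<close>
        have "wp M4 (map_prog (decode_block z [0..<k] A) ?blocks)
            (\<lambda>us M'. list_all2 (\<lambda>u i. \<exists>x. represents M' u x \<and> decoded Rinv i x) us (map (\<lambda>i. i) [0..<m]))"
        proof (rule wp_map_prog)
          show "list_all2 (\<lambda>B i. i < m \<and> B = block_addrs m k i) ?blocks [0..<m]"
            by (auto simp: list_all2_conv_all_nth)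
          fix B i M' assume B: "i < m \<and> B = block_addrs m k i" and "prefix M4 M'"
          then have "extends_input M'" "has_val M' z 0" "has_rows M' A W"
            using input4 z4 W(1) by (auto intro: has_prefix prefix_order.trans)
          then show "wp M' (decode_block z [0..<k] A B) (\<lambda>u M'. \<exists>x. represents M' u x \<and> decoded Rinv i x)"
            using wp_decode_block[OF _ _ _ _ W(2,3) Rinv_def] B by simp
        qed (auto intro: represents_prefix)
        then show ?case
        proof (rule wp_bind, goal_cases)
          case (1 us M5)
          then have len: "length us = m"
            and "\<forall>i<m. \<exists>x. represents M5 (us ! i) x \<and> decoded Rinv i x"
            by (auto simp: list_all2_conv_all_nth)
          then obtain x where x: "\<And>i. i < m \<Longrightarrow> represents M5 (us ! i) (x i)"
            "\<And>i. i < m \<Longrightarrow> decoded Rinv i (x i)"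
            by metis
          \<comment> \<open>This makes the search for \<mu> succeed. A nonzero column stays nonzero
            under the regular \<open>Rinv\<close>, under the injective \<open>psi\<close>, and under
            multiplication by a power of the inverse of \<alpha>, which is nonzero or has exponent
            0.\<close>
          have "x s \<noteq> 0"
          proof
            assume "x s = 0"
            have "\<exists>c<k. nonzero_column k R s c"
              using s(2) by (auto simp: nonzero_unerased_block_def)
            with x(2)[OF s(1)] obtain j where j: "j < k" "nonzero_column k R s j"
              "x s = inverse \<alpha> ^ j * psi \<iota> \<alpha> (Rinv *\<^sub>v received_column k R s j)"
              by (auto simp: decoded_def)
            let ?c = "received_column k R s j"
            have c: "?c \<in> carrier_vec k"
              by (simp add: received_column_def)
            have "psi \<iota> \<alpha> (Rinv *\<^sub>v ?c) = 0"
              using j \<open>x s = 0\<close> alpha_nonzero[OF j(1)] by auto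
            then have "Rinv *\<^sub>v ?c = 0\<^sub>v k"
              using carriers c by (subst (asm) psi_eq_0_iff) auto
            then have "?Rs *\<^sub>v (Rinv *\<^sub>v ?c) = 0\<^sub>v k"
              using carriers by (auto intro!: eq_vecI simp: scalar_prod_def)
            then have "?c = 0\<^sub>v k"
              using assoc_mult_mat_vec[OF carriers(2,1) c] right c by simp
            moreover obtain a where "a < k" "R $$ (a, s * k + j) \<noteq> Some 0" "R $$ (a, s * k + j) \<noteq> None"
              using j(2) by (auto simp: nonzero_column_def unerased_column_def)
            then have "?c $ a \<noteq> 0" "a < k"
              by (auto simp: received_column_def)
            ultimately show False
              by simp
          qed
          have nonzero: "nonzero_cells M5 (us ! i) \<longleftrightarrow> x i \<noteq> 0" if "i < m" for i
            using represents_nonzero_iff[OF x(1)[OF that]] .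
          have "wp M5 (find_nonzero (\<lambda>u. u) us) (\<lambda>first M'. M' = M5 \<and>
              (\<exists>\<mu><m. first = Some (us ! \<mu>) \<and> x \<mu> \<noteq> 0 \<and> (\<forall>i<\<mu>. x i = 0)))"
            by (rule wp_mono[OF wp_find_nonzero])
              (use s(1) len nonzero \<open>x s \<noteq> 0\<close> in \<open>auto split: option.splits\<close>)
          then show ?case
          proof (rule wp_bind, goal_cases)
            case first: (1 first M6)
            then obtain \<mu> where \<mu>: "\<mu> < m" "x \<mu> \<noteq> 0" "\<forall>i<\<mu>. x i = 0"
              and M6: "M6 = M5" and first_eq: "first = Some (us ! \<mu>)"
              by auto
            have input5: "extends_input M5" and z5: "has_val M5 z 0" and e5: "has_val M5 e 1"
              using input4 z4 e4 1(1) by (auto intro: has_prefix prefix_order.trans)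
            have ps: "has_vals M [0..<k] (map (coeff p) [0..<k])" if "extends_input M" for M
              using input_memory_coeff[OF that] by (simp add: degree_p)
            show ?case
              unfolding first_eq M6 option.case
            proof (rule wp_bind[OF wp_ext_inverse[OF z5 e5 ps[OF input5] x(1)[OF \<mu>(1)] \<mu>(2)]], goal_cases)
              case (1 w M7)
              have input7: "extends_input M7" and z7: "has_val M7 z 0"
                using input5 z5 1(1) by (auto intro: has_prefix prefix_order.trans)
              have us7: "list_all2 (represents M7) us (map x [0..<m])"
                using x(1) len 1(1) by (auto simp: list_all2_conv_all_nth intro: represents_prefix)
              have "wp M7 (map_prog (ext_mult z [0..<k] w) us)
                  (\<lambda>vs M. list_all2 (represents M) vs (map ((*) (inverse (x \<mu>))) (map x [0..<m])))"
              proof (rule wp_map_prog[OF us7])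
                fix u v M' assume "represents M7 u v" "prefix M7 M'"
                then show "wp M' (ext_mult z [0..<k] w u) (\<lambda>a M. represents M a (inverse (x \<mu>) * v))"
                  using input7 z7 1(2)
                  by (intro wp_ext_mult ps) (auto intro: has_prefix represents_prefix prefix_order.trans)
              qed (rule represents_prefix)
              moreover have "decoding_output m k \<iota> \<alpha> R (\<lambda>i. inverse (x \<mu>) * x i)"
              proof -
                \<comment> \<open>\<open>decoded\<close> only asserts that a suitable column exists
                  in each nonzero block, whereas the specification asks for one index function. On
                  zero blocks the choice is arbitrary and falls under the other branch.\<close>
                define j where "j i = (SOME j. j < k \<and> nonzero_column k R i j \<and>
                  x i = inverse \<alpha> ^ j * psi \<iota> \<alpha> (Rinv *\<^sub>v received_column k R i j))" for i
                define h where "h i = psi \<iota> \<alpha> (Rinv *\<^sub>v received_column k R i (j i))" for i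
                have "if \<exists>c<k. nonzero_column k R i c
                  then j i < k \<and> nonzero_column k R i (j i) \<and> h i = psi \<iota> \<alpha> (Rinv *\<^sub>v received_column k R i (j i)) \<and>
                    x i = inverse \<alpha> ^ j i * h i
                  else x i = 0" if "i < m" for i
                proof (cases "\<exists>c<k. nonzero_column k R i c")
                  case True
                  with x(2)[OF that] have "\<exists>j. j < k \<and> nonzero_column k R i j \<and>
                    x i = inverse \<alpha> ^ j * psi \<iota> \<alpha> (Rinv *\<^sub>v received_column k R i j)"
                    by (simp add: decoded_def)
                  from someI_ex[OF this, folded j_def] True show ?thesis
                    by (simp add: h_def)
                next
                  case False
                  with x(2)[OF that] have "x i = 0"
                    by (simp add: decoded_def)
                  then show ?thesis
                    unfolding if_not_P[OF False] .
                qed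
                with s carriers(1) inverse \<mu> show ?thesis
                  unfolding decoding_output_def by blast
              qed
              ultimately show ?case
                by (elim wp_mono) (auto simp: comp_def)
            qed
          qed
        qed
      qed
    qed
  qed
qed

lemma decoder_correct:
  "\<exists>w. (\<forall>i<m. w i \<in> carrier_vec k) \<and>
       decoding_output m k \<iota> \<alpha> R (\<lambda>i. psi \<iota> \<alpha> (w i)) \<and>
       run_decoder m k p R = map (\<lambda>i. map Some (list_of_vec (w i))) [0..<m]"
proof -
  obtain vs M where exec: "exec (decoder m k) (input_memory p R) = (vs, M)"
    by force
  with wp_decoder obtain y where y: "list_all2 (represents M) vs (map y [0..<m])"
      "decoding_output m k \<iota> \<alpha> R y"
    by (auto simp: wp_def)
  then have "length vs = m" "\<forall>i<m. \<exists>xs. has_vals M (vs ! i) xs \<and> length xs = k \<and> ev xs = y i"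
    by (auto simp: list_all2_conv_all_nth represents_def)
  then obtain xs where xs: "\<And>i. i < m \<Longrightarrow> has_vals M (vs ! i) (xs i)"
      "\<And>i. i < m \<Longrightarrow> length (xs i) = k" "\<And>i. i < m \<Longrightarrow> ev (xs i) = y i"
    by metis
  let ?w = "\<lambda>i. vec_of_list (xs i)"
  have psi: "psi \<iota> \<alpha> (?w i) = y i" if "i < m" for i
    using that xs by (simp add: psi_eq_ev list_vec)
  have "decoding_output m k \<iota> \<alpha> R (\<lambda>i. psi \<iota> \<alpha> (?w i)) = decoding_output m k \<iota> \<alpha> R y"
    by (rule decoding_output_cong) (rule psi)
  moreover have "map (map ((!) M)) vs = map (\<lambda>i. map Some (xs i)) [0..<m]"
    by (rule nth_equalityI) (simp_all add: \<open>length vs = m\<close> map_nth_has_vals[OF xs(1)])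
  then have "run_decoder m k p R = map (\<lambda>i. map Some (list_of_vec (?w i))) [0..<m]"
    by (simp add: run_decoder_def exec list_vec)
  moreover have "\<forall>i<m. ?w i \<in> carrier_vec k"
    using xs(2) by (auto intro: carrier_vecI)
  ultimately show ?thesis
    using y(2) by (intro exI[of _ ?w]) simp
qed

end

section \<open>Asymptotic bound\<close>

lemma decoder_complexity_bigO:
  "(\<lambda>x. real (decoder_complexity x)) \<in> bigO_params (\<lambda>(m, k). real k ^ 2 * real m + real k ^ 3)"
proof (rule bigoI[where c = 26])
  have "real (decoder_complexity (m, k)) \<le> 26 * (real k ^ 2 * real m + real k ^ 3)"
    if "1 \<le> m" "1 \<le> k" for m k
  proof -
    \<comment> \<open>The two operations creating the constants 0 and 1 are absorbed into
      \<open>2 * k ^ 3\<close>, which turns the coefficient 24 into 26.\<close>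
    have "1 \<le> k ^ 3"
      using that by simp
    then have "decoder_complexity (m, k) \<le> 26 * (k ^ 2 * m + k ^ 3)"
      using max_ops_le[OF bounded_decoder[OF that(2), of m], of "input_size m k"]
      by (simp add: decoder_complexity_def)
    then have "real (decoder_complexity (m, k)) \<le> real (26 * (k ^ 2 * m + k ^ 3))"
      by (simp only: of_nat_le_iff)
    then show ?thesis
      by simp
  qed
  then show "\<forall>\<^sub>F x in principal {(m, k). 1 \<le> m \<and> 1 \<le> k}. norm (real (decoder_complexity x))
      \<le> 26 * norm (case x of (m, k) \<Rightarrow> real k ^ 2 * real m + real k ^ 3)"
    by (auto simp: eventually_principal)
qed

theorem theorem6p4:
  shows "(\<forall>(p :: 'f :: {field, finite} poly) (\<iota> :: 'f \<Rightarrow> 'e :: field) \<alpha> k m R.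
           lead_coeff p = 1 \<and> irreducible p \<and> degree p = k \<and>
           field_hom \<iota> \<and> poly (map_poly \<iota> p) \<alpha> = 0 \<and>
           received m k (companion p) R \<longrightarrow>
           (\<exists>w. (\<forall>i<m. w i \<in> carrier_vec k) \<and>
                decoding_output m k \<iota> \<alpha> R (\<lambda>i. psi \<iota> \<alpha> (w i)) \<and>
                run_decoder m k p R = map (\<lambda>i. map Some (list_of_vec (w i))) [0..<m]))
       \<and> (\<lambda>x. real (decoder_complexity x))
           \<in> bigO_params (\<lambda>(m, k). real k ^ 2 * real m + real k ^ 3)
       \<and> bigO_params (\<lambda>(m, k). real k ^ 2 * real m + real k ^ 3)
           = bigO_params (\<lambda>(m, k). let n = m * k in real k * real n + real k ^ 3)"
proof (intro conjI allI impI)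
  fix p :: "'f poly" and \<iota> :: "'f \<Rightarrow> 'e" and \<alpha> k m R
  assume asm: "lead_coeff p = 1 \<and> irreducible p \<and> degree p = k \<and>
    field_hom \<iota> \<and> poly (map_poly \<iota> p) \<alpha> = 0 \<and> received m k (companion p) R"
  then interpret simple_extension \<iota> \<alpha> "map (coeff p) [0..<k]" k
    using simple_extension_root[of \<iota> p \<alpha>] by auto
  interpret decoding \<iota> \<alpha> p k m R
    by unfold_locales (use asm in auto)
  show "\<exists>w. (\<forall>i<m. w i \<in> carrier_vec k) \<and> decoding_output m k \<iota> \<alpha> R (\<lambda>i. psi \<iota> \<alpha> (w i)) \<and>
      run_decoder m k p R = map (\<lambda>i. map Some (list_of_vec (w i))) [0..<m]"
    by (rule decoder_correct)
next
  show "(\<lambda>x. real (decoder_complexity x)) \<in> bigO_params (\<lambda>(m, k). real k ^ 2 * real m + real k ^ 3)"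
    by (rule decoder_complexity_bigO)
next
  have "(\<lambda>(m, k). real k ^ 2 * real m + real k ^ 3) =
      (\<lambda>(m, k). let n = m * k in real k * real n + real k ^ 3)"
    by (auto simp: Let_def power2_eq_square)
  then show "bigO_params (\<lambda>(m, k). real k ^ 2 * real m + real k ^ 3) =
      bigO_params (\<lambda>(m, k). let n = m * k in real k * real n + real k ^ 3)"
    by (rule arg_cong)
qed

end
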